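(* Let $m,n$ be positive integers with $\gcd(m,n)=1$ and let $\mathbb{H}_{m/n}=\{(z_1,z_2)\in\mathbb{C}^2:|z_1|^{m/n}<|z_2|<1\}$. Let $p_k=\frac{2m+2n}{1-k}$ for integers $k\le 0$, and let $q_k$ denote the conjugate exponent of $p_k$ (with the convention $p_1=\infty$, $q_1=1$). Let $k\in\{1-m-n,2-m-n,\dots,-1\}$ and let $p\in[p_k,p_{k+1})$. Then: (i) $\big|\widetilde{\mathbf{B}^p}\big|$ is bounded on $L^{p'}(\mathbb{H}_{m/n})$ for all $p'\in(q_{k+1},p_{k+1})$. (ii) $\big|\widetilde{\mathbf{B}^\infty}\big|$ is a bounded operator on $L^{r}(\mathbb{H}_{m/n})$ for all $r\in(1,\infty)$.
   Context: For $2\le p\le\infty$ the $L^p$ sub-Bergman kernel of $\mathbb{H}_{m/n}$ is $\widetilde{B^p}(z,w)=\sum_{\alpha}\frac{z^\alpha\overline{w^\alpha}}{\|z^\alpha\|_{L^2(\mathbb{H}_{m/n})}^2}$, where the sum is over all $\alpha\in\mathbb{Z}^2$ such that the monomial $z^\alpha=z_1^{\alpha_1}z_2^{\alpha_2}$ is holomorphic on $\mathbb{H}_{m/n}$ and belongs to $L^p(\mathbb{H}_{m/n})$ (Lebesgue measure $dV$). For $p\in[p_k,p_{k+1})$ this index set is $\{\alpha:\alpha_1\ge0,\ n\alpha_1+m\alpha_2\ge k\}$, and for $p=\infty$ it is $\{\alpha:\alpha_1\ge0,\ n\alpha_1+m\alpha_2\ge0\}$. $\widetilde{\mathbf{B}^p}$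 is the integral operator with kernel $\widetilde{B^p}(z,w)$, and $\big|\widetilde{\mathbf{B}^p}\big|f(z)=\int_{\mathbb{H}_{m/n}}\big|\widetilde{B^p}(z,w)\big|f(w)\,dV(w)$. *)

theory Defs
  imports "HOL-Analysis.Analysis"
begin

definition hartogs :: "nat \<Rightarrow> nat \<Rightarrow> (complex \<times> complex) set" where
  "hartogs m n =
     {(z1, z2). norm z1 powr (real m / real n) < norm z2 \<and> norm z2 < 1}"

abbreviation dV :: "nat \<Rightarrow> nat \<Rightarrow> (complex \<times> complex) measure" where
  "dV m n \<equiv> lebesgue_on (hartogs m n)"

text \<open>Functions rather than equivalence classes modulo null sets; intended for
  exponents \<open>1 \<le> p \<le> \<infinity>\<close>.\<close>

definition Lp :: "ereal \<Rightarrow> 'a measure \<Rightarrow> ('a \<Rightarrow> complex) set" where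
  "Lp p M = {f \<in> borel_measurable M.
     if p = \<infinity> then \<exists>C. AE x in M. norm (f x) \<le> C
     else integrable M (\<lambda>x. norm (f x) powr real_of_ereal p)}"

definition Lp_norm :: "real \<Rightarrow> 'a measure \<Rightarrow> ('a \<Rightarrow> complex) \<Rightarrow> real" where
  "Lp_norm p M f = (\<integral>x. norm (f x) powr p \<partial>M) powr (1 / p)"

text \<open>Holomorphy in two variables on an open set: the real Frechet derivative
  exists at every point and is complex linear.\<close>

definition holomorphic2_on ::
    "(complex \<times> complex \<Rightarrow> complex) \<Rightarrow> (complex \<times> complex) set \<Rightarrow> bool" where
  "holomorphic2_on f S \<longleftrightarrow>
     (\<forall>z\<in>S. \<exists>a b. (f has_derivative (\<lambda>v. a * fst v + b * snd v)) (at z))"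

text \<open>Where \<open>z\<^sub>1 = 0\<close> and \<open>\<alpha>\<^sub>1 < 0\<close>, \<open>powi\<close> returns the
  value \<open>0\<close>; the monomial is unbounded near such a point, so it is still not
  holomorphic on a set containing one.\<close>

definition monomial :: "int \<times> int \<Rightarrow> complex \<times> complex \<Rightarrow> complex" where
  "monomial \<alpha> z = fst z powi fst \<alpha> * snd z powi snd \<alpha>"

definition sub_bergman_index :: "nat \<Rightarrow> nat \<Rightarrow> ereal \<Rightarrow> (int \<times> int) set" where
  "sub_bergman_index m n p =
     {\<alpha>. holomorphic2_on (monomial \<alpha>) (hartogs m n) \<and> monomial \<alpha> \<in> Lp p (dV m n)}"

definition sub_bergman_kernel ::
    "nat \<Rightarrow> nat \<Rightarrow> ereal \<Rightarrow> complex \<times> complex \<Rightarrow> complex \<times> complex \<Rightarrow> complex" where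
  "sub_bergman_kernel m n p z w =
     (\<Sum>\<^sub>\<infinity>\<alpha>\<in>sub_bergman_index m n p.
        monomial \<alpha> z * cnj (monomial \<alpha> w)
          / of_real ((Lp_norm 2 (dV m n) (monomial \<alpha>))\<^sup>2))"

definition integral_op ::
    "'a measure \<Rightarrow> ('a \<Rightarrow> 'a \<Rightarrow> complex) \<Rightarrow> ('a \<Rightarrow> complex) \<Rightarrow> 'a \<Rightarrow> complex" where
  "integral_op M K f z = (\<integral>w. K z w * f w \<partial>M)"

text \<open>Convergence of the defining integral for almost every \<open>z\<close> is part of
  boundedness, since a divergent Bochner integral has the value \<open>0\<close>.\<close>

definition integral_op_bounded_on_Lp ::
    "real \<Rightarrow> 'a measure \<Rightarrow> ('a \<Rightarrow> 'a \<Rightarrow> complex) \<Rightarrow> bool" where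
  "integral_op_bounded_on_Lp p M K \<longleftrightarrow>
     (\<exists>C. \<forall>f \<in> Lp (ereal p) M.
        (AE z in M. integrable M (\<lambda>w. K z w * f w)) \<and>
        integral_op M K f \<in> Lp (ereal p) M \<and>
        Lp_norm p M (integral_op M K f) \<le> C * Lp_norm p M f)"

definition abs_sub_bergman_kernel ::
    "nat \<Rightarrow> nat \<Rightarrow> ereal \<Rightarrow> complex \<times> complex \<Rightarrow> complex \<times> complex \<Rightarrow> complex" where
  "abs_sub_bergman_kernel m n p z w = of_real (norm (sub_bergman_kernel m n p z w))"

text \<open>Division in \<^typ>\<open>ereal\<close> gives \<open>p\<^sub>1 = \<infinity>\<close> and \<open>q\<^sub>1 = 1\<close>.\<close>

definition p_exponent :: "nat \<Rightarrow> nat \<Rightarrow> int \<Rightarrow> ereal" where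
  "p_exponent m n k = ereal (2 * real m + 2 * real n) / ereal (1 - real_of_int k)"

definition conjugate_exponent :: "ereal \<Rightarrow> ereal" where
  "conjugate_exponent p = 1 / (1 - 1 / p)"

definition q_exponent :: "nat \<Rightarrow> nat \<Rightarrow> int \<Rightarrow> ereal" where
  "q_exponent m n k = conjugate_exponent (p_exponent m n k)"

end

theory Submission
  imports Defs "HOL-Complex_Analysis.Cauchy_Integral_Formula"
begin

text \<open>Put \<open>s = z\<^sub>1 cnj w\<^sub>1\<close>, \<open>t = z\<^sub>2 cnj w\<^sub>2\<close> and \<open>u = s\<^sup>m / t\<^sup>n\<close>. Summing the series over the index set
  \<open>\<alpha>\<^sub>1 \<ge> 0\<close>, \<open>n \<alpha>\<^sub>1 + m \<alpha>\<^sub>2 \<ge> k\<close> gives a finite sum of rational functions, and it follows that the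
  kernel is dominated by a multiple of \<open>|t| powr (k / m) / (|1 - u|\<^sup>2 |1 - t|\<^sup>2)\<close>. Schur's test is applied
  to this majorant with the weight
  \<open>|w\<^sub>2| powr a * (1 - |w\<^sub>2|\<^sup>2) powr -\<epsilon> * (1 - |w\<^sub>1\<^sup>m / w\<^sub>2\<^sup>n|\<^sup>2) powr -\<epsilon>\<close>. After the substitution
  \<open>w\<^sub>1 = |w\<^sub>2| powr (n / m) * v\<close> the integrals split into two integrals over the unit disc; averaging over
  rotations turns \<open>1 / |1 - c v\<^sup>m|\<^sup>2\<close> into \<open>1 / (1 - |c|\<^sup>2 |v| powr (2 m))\<close> and leaves one-dimensional integrals.
  The test succeeds for the exponent \<open>P\<close> with conjugate \<open>Q\<close> as soon as \<open>a P\<close> and \<open>a Q\<close> both lie in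
  \<open>(-(2 m + 2 n + k) / m, k / m]\<close>, and such an \<open>a\<close> exists exactly for \<open>q\<^sub>k\<^sub>+\<^sub>1 < P < p\<^sub>k\<^sub>+\<^sub>1\<close>
  (for \<open>k = 0\<close> one takes \<open>a = 0\<close>).\<close>

section \<open>Planar Lebesgue measure\<close>

text \<open>The coefficients of the series grow linearly in each of the two summation indices,
  whence the double poles at \<open>u = 1\<close> and \<open>t = 1\<close>. Such factors alone would
  allow every exponent in \<open>(1, \<infinity>)\<close>. The range is cut down only at
  \<open>z\<^sub>2 = 0\<close>, where for \<open>k < 0\<close> the factor
  \<open>|t| powr (k / m)\<close> blows up; the power of \<open>|w\<^sub>2|\<close> in the weight is
  there to balance it. Let \<open>s\<close> be \<open>P\<close> or \<open>Q\<close>. Integration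
  against the \<open>s\<close>-th power of the weight returns
  \<open>|z\<^sub>2| powr (k / m)\<close> whatever \<open>a\<close> is, and the weight dominates
  this only if \<open>a s \<le> k / m\<close>. Convergence at \<open>w\<^sub>2 = 0\<close> asks that
  the total exponent \<open>2 n / m + k / m + a s\<close> exceed -2. One \<open>a\<close> must serve
  both values of \<open>s\<close>, so for \<open>k < 0\<close> the smaller exponent is given the
  borderline value \<open>k / m\<close>, and the larger must satisfy
  \<open>max / min < (2 m + 2 n + k) / (- k)\<close>. Conjugacy gives
  \<open>max / min = max - 1\<close>, so the condition reads
  \<open>max < (2 m + 2 n) / (- k)\<close>, which is the exponent with index \<open>k + 1\<close>.
  The factors with \<open>\<epsilon>\<close> ask only that \<open>\<epsilon> P\<close> and
  \<open>\<epsilon> Q\<close> lie strictly between 0 and 1.\<close>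

lemma lborel_complex_eq:
  "(lborel :: complex measure) = distr (lborel \<Otimes>\<^sub>M lborel) borel (\<lambda>(x, y). Complex x y)"
proof (rule lborel_eqI)
  have m[measurable]: "(\<lambda>(x, y). Complex x y) \<in> (lborel \<Otimes>\<^sub>M lborel) \<rightarrow>\<^sub>M borel"
  proof -
    have "(\<lambda>(x, y). Complex x y) \<in> borel_measurable borel"
      unfolding case_prod_beta Complex_eq
      by (intro borel_measurable_continuous_onI continuous_intros)
    then show ?thesis by (simp add: lborel_prod)
  qed
  fix l u :: complex
  assume le: "\<And>b. b \<in> Basis \<Longrightarrow> l \<bullet> b \<le> u \<bullet> b"
  then have le': "Re l \<le> Re u" "Im l \<le> Im u"
    using le[of 1] le[of \<i>] by (simp_all add: Basis_complex_def inner_complex_def)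
  have "(\<lambda>(x, y). Complex x y) -` box l u \<inter> space (lborel \<Otimes>\<^sub>M lborel)
      = {Re l <..< Re u} \<times> {Im l <..< Im u}"
    by (auto simp: box_def Basis_complex_def inner_complex_def space_pair_measure)
  then have "emeasure (distr (lborel \<Otimes>\<^sub>M lborel) borel (\<lambda>(x, y). Complex x y)) (box l u)
      = emeasure (lborel \<Otimes>\<^sub>M lborel) ({Re l <..< Re u} \<times> {Im l <..< Im u})"
    by (subst emeasure_distr) auto
  also have "\<dots> = ennreal (Re u - Re l) * ennreal (Im u - Im l)"
    using le' by (subst lborel.emeasure_pair_measure_Times) auto
  also have "\<dots> = ennreal (\<Prod>b\<in>Basis. (u - l) \<bullet> b)"
    using le' by (simp add: Basis_complex_def inner_complex_def ennreal_mult complex_eq_iff)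
  finally show "emeasure (distr (lborel \<Otimes>\<^sub>M lborel) borel (\<lambda>(x, y). Complex x y)) (box l u)
      = ennreal (\<Prod>b\<in>Basis. (u - l) \<bullet> b)" .
qed simp

lemma measurable_Complex[measurable (raw)]:
  assumes "f \<in> borel_measurable M" "g \<in> borel_measurable M"
  shows "(\<lambda>x. Complex (f x) (g x)) \<in> borel_measurable M"
  unfolding Complex_eq using assms by measurable

text \<open>Both orders of integration are recorded because each of the two kinds of shear moves the
  inner variable of one of them.\<close>

lemma nn_integral_complex_iterated:
  fixes F :: "complex \<Rightarrow> ennreal"
  assumes [measurable]: "F \<in> borel_measurable borel"
  shows "(\<integral>\<^sup>+z. F z \<partial>lborel) = (\<integral>\<^sup>+y. \<integral>\<^sup>+x. F (Complex x y) \<partial>lborel \<partial>lborel)"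
    and "(\<integral>\<^sup>+z. F z \<partial>lborel) = (\<integral>\<^sup>+x. \<integral>\<^sup>+y. F (Complex x y) \<partial>lborel \<partial>lborel)"
proof -
  have "(\<integral>\<^sup>+z. F z \<partial>lborel) = (\<integral>\<^sup>+(x, y). F (Complex x y) \<partial>(lborel \<Otimes>\<^sub>M lborel))"
    unfolding case_prod_beta by (subst lborel_complex_eq, subst nn_integral_distr) (auto simp: case_prod_beta)
  moreover have "\<dots> = (\<integral>\<^sup>+y. \<integral>\<^sup>+x. F (Complex x y) \<partial>lborel \<partial>lborel)"
    by (subst lborel_pair.nn_integral_snd[symmetric]) auto
  moreover have "(\<integral>\<^sup>+(x, y). F (Complex x y) \<partial>(lborel \<Otimes>\<^sub>M lborel))
     = (\<integral>\<^sup>+x. \<integral>\<^sup>+y. F (Complex x y) \<partial>lborel \<partial>lborel)"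
    by (subst lborel.nn_integral_fst[symmetric]) auto
  ultimately show "(\<integral>\<^sup>+z. F z \<partial>lborel) = (\<integral>\<^sup>+y. \<integral>\<^sup>+x. F (Complex x y) \<partial>lborel \<partial>lborel)"
    and "(\<integral>\<^sup>+z. F z \<partial>lborel) = (\<integral>\<^sup>+x. \<integral>\<^sup>+y. F (Complex x y) \<partial>lborel \<partial>lborel)" by simp_all
qed

lemma nn_integral_lborel_translate:
  fixes f :: "real \<Rightarrow> ennreal"
  assumes [measurable]: "f \<in> borel_measurable borel"
  shows "(\<integral>\<^sup>+x. f (x + t) \<partial>lborel) = (\<integral>\<^sup>+x. f x \<partial>lborel)"
  using nn_integral_real_affine[of f 1 t] by (simp add: add.commute)

text \<open>With the outer coordinate fixed, a shear is a translation of the inner one.\<close>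

lemma nn_integral_complex_shear:
  fixes F :: "complex \<Rightarrow> ennreal"
  assumes [measurable]: "F \<in> borel_measurable borel"
  shows "(\<integral>\<^sup>+z. F (Complex (Re z + a * Im z) (Im z)) \<partial>lborel) = (\<integral>\<^sup>+z. F z \<partial>lborel)"
    and "(\<integral>\<^sup>+z. F (Complex (Re z) (Im z + a * Re z)) \<partial>lborel) = (\<integral>\<^sup>+z. F z \<partial>lborel)"
proof -
  have [measurable]: "(\<lambda>x. F (Complex x y)) \<in> borel_measurable borel"
    "(\<lambda>y. F (Complex x y)) \<in> borel_measurable borel" for x y by measurable
  show "(\<integral>\<^sup>+z. F (Complex (Re z + a * Im z) (Im z)) \<partial>lborel) = (\<integral>\<^sup>+z. F z \<partial>lborel)"
    by (simp add: nn_integral_complex_iterated(1) nn_integral_lborel_translate[where f = "\<lambda>x. F (Complex x y)" for y])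
  show "(\<integral>\<^sup>+z. F (Complex (Re z) (Im z + a * Re z)) \<partial>lborel) = (\<integral>\<^sup>+z. F z \<partial>lborel)"
    by (simp add: nn_integral_complex_iterated(2) nn_integral_lborel_translate[where f = "\<lambda>y. F (Complex x y)" for x])
qed

lemma nn_integral_complex_rotate:
  fixes F :: "complex \<Rightarrow> ennreal"
  assumes [measurable]: "F \<in> borel_measurable borel" and c: "norm c = 1"
  shows "(\<integral>\<^sup>+z. F (c * z) \<partial>lborel) = (\<integral>\<^sup>+z. F z \<partial>lborel)"
proof -
  text \<open>A rotation by an angle other than \<open>\<pi>\<close> is a product of three shears.\<close>
  have *: "(\<integral>\<^sup>+z. F (d * z) \<partial>lborel) = (\<integral>\<^sup>+z. F z \<partial>lborel)"
    if [measurable]: "F \<in> borel_measurable borel" and d: "norm d = 1" "d \<noteq> -1"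
    for d and F :: "complex \<Rightarrow> ennreal"
  proof -
    \<comment> \<open>For \<open>d\<close> of argument \<theta>, \<open>p\<close> and
      \<open>q\<close> are its cosine and sine and \<open>t\<close> is minus the tangent of
      \<theta>/2; the denominator vanishes only at \<open>d = -1\<close>.\<close>
    define p q t where "p = Re d" and "q = Im d" and "t = - q / (1 + p)"
    have pq: "p\<^sup>2 + q\<^sup>2 = 1" using d(1) by (simp add: p_def q_def cmod_def)
    have p: "1 + p \<noteq> 0"
    proof
      assume "1 + p = 0"
      then have "p = -1" by simp
      with pq have "q = 0" by simp
      with \<open>p = -1\<close> d(2) show False by (simp add: p_def q_def complex_eq_iff)
    qed
    have t: "t * (1 + p) = - q" using p by (simp add: t_def)
    have "(1 + p) * (t * q) = (1 + p) * (p - 1)" using t pq by algebra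
    then have tq: "t * q = p - 1" using p by simp
    define X Y where "X z = Complex (Re z + t * Im z) (Im z)"
      and "Y z = Complex (Re z) (Im z + q * Re z)" for z
    have [measurable]: "X \<in> borel_measurable borel" "Y \<in> borel_measurable borel"
      unfolding X_def[abs_def] Y_def[abs_def] by measurable
    have X: "(\<integral>\<^sup>+z. G (X z) \<partial>lborel) = (\<integral>\<^sup>+z. G z \<partial>lborel)"
      and Y: "(\<integral>\<^sup>+z. G (Y z) \<partial>lborel) = (\<integral>\<^sup>+z. G z \<partial>lborel)"
      if "G \<in> borel_measurable borel" for G :: "complex \<Rightarrow> ennreal"
      unfolding X_def Y_def using that by (rule nn_integral_complex_shear)+
    have "(\<integral>\<^sup>+z. F (X (Y (X z))) \<partial>lborel) = (\<integral>\<^sup>+z. F (X (Y z)) \<partial>lborel)"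
      by (rule X) measurable
    also have "\<dots> = (\<integral>\<^sup>+z. F (X z) \<partial>lborel)"
      by (rule Y) measurable
    also have "\<dots> = (\<integral>\<^sup>+z. F z \<partial>lborel)"
      by (rule X) measurable
    also have "(\<lambda>z. F (X (Y (X z)))) = (\<lambda>z. F (d * z))"
    proof (rule ext)
      fix z
      have *: "Im z + q * (Re z + t * Im z) = q * Re z + p * Im z"
        using tq by algebra
      have "Re z + t * Im z + t * (q * Re z + p * Im z) = p * Re z - q * Im z"
        using tq t by algebra
      with * have "X (Y (X z)) = d * z"
        by (simp add: X_def Y_def complex_eq_iff p_def q_def)
      then show "F (X (Y (X z))) = F (d * z)" by simp
    qed
    finally show ?thesis .
  qed
  \<comment> \<open>A principal square root has nonnegative real part, so \<open>d\<close> is never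
    -1, and rotating twice by \<open>d\<close> covers \<open>c = -1\<close> as well.\<close>
  define d where "d = csqrt c"
  have d: "norm d = 1" "d * d = c"
    using c by (auto simp: d_def norm_csqrt simp flip: power2_eq_square)
  have "d \<noteq> -1" using csqrt_principal[of c] by (auto simp: d_def simp del: csqrt.simps)
  have "(\<integral>\<^sup>+z. F (c * z) \<partial>lborel) = (\<integral>\<^sup>+z. F (d * (d * z)) \<partial>lborel)"
    by (simp add: d mult.assoc[symmetric])
  also have "\<dots> = (\<integral>\<^sup>+z. F (d * z) \<partial>lborel)"
    by (rule *) (use d \<open>d \<noteq> -1\<close> in auto)
  also have "\<dots> = (\<integral>\<^sup>+z. F z \<partial>lborel)"
    by (rule *) (use d \<open>d \<noteq> -1\<close> in auto)
  finally show ?thesis .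
qed

lemma nn_integral_complex_scale:
  fixes F :: "complex \<Rightarrow> ennreal"
  assumes [measurable]: "F \<in> borel_measurable borel" and R: "R > 0"
  shows "(\<integral>\<^sup>+z. F z \<partial>lborel) = ennreal (R\<^sup>2) * (\<integral>\<^sup>+z. F (of_real R * z) \<partial>lborel)"
proof -
  have "(\<integral>\<^sup>+z. F z \<partial>lborel)
      = (\<integral>\<^sup>+z. F z \<partial>density (distr lborel borel (\<lambda>x. 0 + R *\<^sub>R x)) (\<lambda>_. \<bar>R\<bar> ^ DIM(complex)))"
    using R by (subst lborel_affine[of R 0]) auto
  also have "\<dots> = ennreal (R\<^sup>2) * (\<integral>\<^sup>+z. F (of_real R * z) \<partial>lborel)"
    using R by (subst nn_integral_density) 
      (auto simp: nn_integral_distr nn_integral_cmult scaleR_conv_of_real)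
  finally show ?thesis .
qed

text \<open>A disc of radius \<open>sqrt r\<close> has area \<open>pi * r\<close>, so the square of
  the modulus is uniformly distributed on the half-line. For this reason radial integrals are
  written in that variable, with no Jacobian left over.\<close>

lemma distr_norm_square:
  "distr lborel borel (\<lambda>z::complex. (norm z)\<^sup>2) = density lborel (\<lambda>t. ennreal pi * indicator {0..} t)"
proof (rule measure_eqI_generator_eq[where E = "range (\<lambda>r::real. {..r})" and \<Omega> = UNIV and A = "\<lambda>n. {..real n}"])
  show "Int_stable (range (\<lambda>r::real. {..r}))"
    by (auto simp: Int_stable_def)
  show "sets (distr lborel borel (\<lambda>z::complex. (norm z)\<^sup>2)) = sigma_sets UNIV (range (\<lambda>r::real. {..r}))"
    "sets (density lborel (\<lambda>t. ennreal pi * indicator {0..} t)) = sigma_sets UNIV (range (\<lambda>r::real. {..r}))"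
    by (simp_all add: borel_eq_atMost)
  show "(\<Union>i. {..real i}) = UNIV"
    using real_arch_simple by auto
  have e: "emeasure (distr lborel borel (\<lambda>z::complex. (norm z)\<^sup>2)) {..r} = ennreal (pi * max 0 r)" for r
  proof (cases "r \<ge> 0")
    case True
    have "(\<lambda>z::complex. (norm z)\<^sup>2) -` {..r} = cball 0 (sqrt r)"
      using real_sqrt_le_iff[of "(norm z)\<^sup>2" r for z :: complex] by (auto simp: dist_norm)
    then show ?thesis
      using True by (subst emeasure_distr) (auto simp: emeasure_cball unit_ball_vol_2 DIM_complex mult.commute)
  next
    case False
    then have "(\<lambda>z::complex. (norm z)\<^sup>2) -` {..r} = {}"
      by (auto simp: not_le) (metis leD order_less_le_trans zero_le_power2)
    then show ?thesis using False by (subst emeasure_distr) auto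
  qed
  have f: "emeasure (density lborel (\<lambda>t. ennreal pi * indicator {0..} t)) {..r} = ennreal (pi * max 0 r)" for r
  proof -
    have "emeasure (density lborel (\<lambda>t. ennreal pi * indicator {0..} t)) {..r}
        = (\<integral>\<^sup>+t. ennreal pi * indicator {0..r} t \<partial>lborel)"
      by (subst emeasure_density) (auto intro!: nn_integral_cong split: split_indicator)
    also have "\<dots> = ennreal (pi * max 0 r)"
      by (cases "r \<ge> 0") (auto simp: nn_integral_cmult ennreal_mult)
    finally show ?thesis .
  qed
  show "emeasure (distr lborel borel (\<lambda>z::complex. (norm z)\<^sup>2)) X
      = emeasure (density lborel (\<lambda>t. ennreal pi * indicator {0..} t)) X"
    if "X \<in> range (\<lambda>r::real. {..r})" for X using that e f by auto
  show "emeasure (distr lborel borel (\<lambda>z::complex. (norm z)\<^sup>2)) {..real i} \<noteq> \<infinity>" for i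
    by (simp add: e)
qed auto

lemma nn_integral_radial:
  fixes g :: "real \<Rightarrow> ennreal"
  assumes [measurable]: "g \<in> borel_measurable borel"
  shows "(\<integral>\<^sup>+(z::complex). g ((norm z)\<^sup>2) \<partial>lborel) = ennreal pi * (\<integral>\<^sup>+t. g t * indicator {0..} t \<partial>lborel)"
proof -
  have "(\<integral>\<^sup>+(z::complex). g ((norm z)\<^sup>2) \<partial>lborel)
      = (\<integral>\<^sup>+t. g t \<partial>distr lborel borel (\<lambda>z::complex. (norm z)\<^sup>2))"
    by (subst nn_integral_distr) auto
  also have "\<dots> = (\<integral>\<^sup>+t. ennreal pi * (g t * indicator {0..} t) \<partial>lborel)"
    unfolding distr_norm_square by (subst nn_integral_density) (auto simp: ac_simps)
  finally show ?thesis by (simp add: nn_integral_cmult)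
qed

section \<open>Integrals over the unit disc\<close>

lemma ennreal_lincomb:
  assumes "0 \<le> a" "0 \<le> x" "0 \<le> b" "0 \<le> y"
  shows "ennreal (a * x + b * y) = ennreal a * ennreal x + ennreal b * ennreal y"
  using assms by (simp add: ennreal_plus ennreal_mult del: ennreal_plus_if)

lemma nn_integral_powr_from_0:
  fixes a c :: real
  assumes "a > -1" "c \<ge> 0"
  shows "(\<integral>\<^sup>+t. ennreal (t powr a * indicator {0..c} t) \<partial>lborel) = ennreal (c powr (a + 1) / (a + 1))"
proof (rule nn_integral_has_integral_lborel)
  have "((\<lambda>t. if t \<in> {0..c} then t powr a else 0) has_integral c powr (a + 1) / (a + 1)) UNIV"
    using has_integral_powr_from_0[OF assms] by (simp only: has_integral_restrict_UNIV)
  then show "((\<lambda>t. t powr a * indicator {0..c} t) has_integral c powr (a + 1) / (a + 1)) UNIV"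
    by (rule has_integral_eq_rhs[OF has_integral_eq, rotated]) (auto simp: indicator_def)
qed auto

lemma nn_integral_powr_to_inf:
  fixes a c :: real
  assumes "a < -1" "c > 0"
  shows "(\<integral>\<^sup>+t. ennreal (t powr a * indicator {c..} t) \<partial>lborel) = ennreal (- (c powr (a + 1)) / (a + 1))"
proof (rule nn_integral_has_integral_lborel)
  have "((\<lambda>t. if t \<in> {c..} then t powr a else 0) has_integral - (c powr (a + 1)) / (a + 1)) UNIV"
    using has_integral_powr_to_inf[OF assms] by (simp only: has_integral_restrict_UNIV)
  then show "((\<lambda>t. t powr a * indicator {c..} t) has_integral - (c powr (a + 1)) / (a + 1)) UNIV"
    by (rule has_integral_eq_rhs[OF has_integral_eq, rotated]) (auto simp: indicator_def)
qed auto

text \<open>Split at \<open>t = \<delta>\<close>: below it the denominator is at least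
  \<open>\<delta>\<close>, above it at least \<open>t\<close>. Each piece is a multiple of
  \<open>\<delta> powr -\<epsilon>\<close>; the first converges at 0 since
  \<open>\<epsilon> < 1\<close>, the second at infinity since \<open>\<epsilon> > 0\<close>.\<close>

lemma nn_integral_powr_div_add_le:
  fixes \<epsilon> \<delta> :: real
  assumes "0 < \<epsilon>" "\<epsilon> < 1" "\<delta> > 0"
  shows "(\<integral>\<^sup>+t. ennreal (t powr -\<epsilon> / (t + \<delta>) * indicator {0..} t) \<partial>lborel)
      \<le> ennreal ((1 / (1 - \<epsilon>) + 1 / \<epsilon>) * \<delta> powr -\<epsilon>)"
proof -
  have "(\<integral>\<^sup>+t. ennreal (t powr -\<epsilon> / (t + \<delta>) * indicator {0..} t) \<partial>lborel)
     \<le> (\<integral>\<^sup>+t. ennreal (1 / \<delta>) * ennreal (t powr -\<epsilon> * indicator {0..\<delta>} t)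
           + ennreal (t powr (-\<epsilon> - 1) * indicator {\<delta>..} t) \<partial>lborel)"
  proof (rule nn_integral_mono)
    fix t :: real
    have "t powr -\<epsilon> / (t + \<delta>) * indicator {0..} t
        \<le> 1 / \<delta> * (t powr -\<epsilon> * indicator {0..\<delta>} t) + t powr (-\<epsilon> - 1) * indicator {\<delta>..} t"
    proof (cases "t \<ge> 0")
      case t: True
      show ?thesis
      proof (cases "t \<le> \<delta>")
        case True
        have "t powr -\<epsilon> / (t + \<delta>) \<le> t powr -\<epsilon> / \<delta>"
          using t assms by (intro divide_left_mono) auto
        with t True show ?thesis by (auto simp: indicator_def intro: add_increasing2)
      next
        case False
        have "t powr -\<epsilon> / (t + \<delta>) \<le> t powr -\<epsilon> / t"
          using t False assms by (intro divide_left_mono) auto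
        also have "\<dots> = t powr (-\<epsilon> - 1)"
          using t False assms by (simp add: powr_diff)
        finally show ?thesis using t False by (auto simp: indicator_def)
      qed
    qed (use assms in \<open>auto simp: indicator_def\<close>)
    then show "ennreal (t powr -\<epsilon> / (t + \<delta>) * indicator {0..} t)
        \<le> ennreal (1 / \<delta>) * ennreal (t powr -\<epsilon> * indicator {0..\<delta>} t)
           + ennreal (t powr (-\<epsilon> - 1) * indicator {\<delta>..} t)"
      using assms by (simp add: ennreal_leI flip: ennreal_plus ennreal_mult')
  qed
  also have "\<dots> = ennreal (1 / \<delta>) * ennreal (\<delta> powr (-\<epsilon> + 1) / (-\<epsilon> + 1))
      + ennreal (- (\<delta> powr (-\<epsilon> - 1 + 1)) / (-\<epsilon> - 1 + 1))"
    using assms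
    by (simp add: nn_integral_add nn_integral_cmult nn_integral_powr_from_0 nn_integral_powr_to_inf)
  also have "\<dots> = ennreal ((1 / (1 - \<epsilon>) + 1 / \<epsilon>) * \<delta> powr -\<epsilon>)"
  proof -
    have "\<delta> powr (-\<epsilon> + 1) = \<delta> * \<delta> powr -\<epsilon>"
      using assms by (simp only: powr_add) simp
    then have "(1 / (1 - \<epsilon>) + 1 / \<epsilon>) * \<delta> powr -\<epsilon>
        = 1 / \<delta> * (\<delta> powr (-\<epsilon> + 1) / (-\<epsilon> + 1)) + 1 * (- (\<delta> powr (-\<epsilon> - 1 + 1)) / (-\<epsilon> - 1 + 1))"
      using assms by (simp add: field_simps)
    then show ?thesis
      using assms by (simp only:) (subst ennreal_lincomb; simp)
  qed
  finally show ?thesis .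
qed

text \<open>The one-dimensional Forelli-Rudin estimate. The singularities at 0 and at 1 are
  separated at \<open>t = 1 / 2\<close>. On the left only \<open>t powr \<beta>\<close> matters and
  the contribution is bounded independently of \<open>\<rho>\<close>; it is absorbed because
  \<open>(1 - \<rho>) powr -\<epsilon> \<ge> 1\<close>. On the right \<open>t powr \<beta>\<close>
  is bounded by \<open>c\<close>, and \<open>1 - \<rho> * t\<close> is comparable to the sum of the
  distances of \<open>t\<close> and \<open>\<rho>\<close> from 1.\<close>

lemma nn_integral_powr_kernel_le:
  fixes \<beta> \<epsilon> :: real
  assumes "\<beta> > -1" "0 < \<epsilon>" "\<epsilon> < 1"
  obtains C where "C \<ge> 0"
    "\<And>\<rho>. 0 \<le> \<rho> \<Longrightarrow> \<rho> < 1 \<Longrightarrow>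
      (\<integral>\<^sup>+t. ennreal (t powr \<beta> * (1 - t) powr -\<epsilon> / (1 - \<rho> * t) * indicator {0..<1} t) \<partial>lborel)
        \<le> ennreal (C * (1 - \<rho>) powr -\<epsilon>)"
proof -
  define c where "c = max 1 (2 powr -\<beta>)"
  define D where "D = 1 / (1 - \<epsilon>) + 1 / \<epsilon>"
  define C where "C = 2 powr \<epsilon> * 2 / (\<beta> + 1) + 2 * c * D"
  have c: "c \<ge> 1" and D: "D \<ge> 0" using assms by (auto simp: c_def D_def)
  have C: "C \<ge> 0" using assms c D by (auto simp: C_def)
  have "(\<integral>\<^sup>+t. ennreal (t powr \<beta> * (1 - t) powr -\<epsilon> / (1 - \<rho> * t) * indicator {0..<1} t) \<partial>lborel)
        \<le> ennreal (C * (1 - \<rho>) powr -\<epsilon>)" if \<rho>: "0 \<le> \<rho>" "\<rho> < 1" for \<rho>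
  proof -
    have pw: "t powr \<beta> * (1 - t) powr -\<epsilon> / (1 - \<rho> * t) * indicator {0..<1} t
        \<le> (2 powr \<epsilon> * 2) * (t powr \<beta> * indicator {0..1} t)
          + 2 * c * ((1 - t) powr -\<epsilon> / ((1 - t) + (1 - \<rho>)) * indicator {0..} (1 - t))" for t
    proof (cases "0 \<le> t \<and> t < 1")
      case t: True
      have nn: "0 \<le> 2 * c * ((1 - t) powr -\<epsilon> / ((1 - t) + (1 - \<rho>)) * indicator {0..} (1 - t))"
        using t c \<rho> by (auto simp: indicator_def)
      have \<rho>t: "\<rho> * t \<le> t" using \<rho> t by (simp add: mult_left_le_one_le)
      show ?thesis
      proof (cases "t \<le> 1 / 2")
        case True
        have "(1 - t) powr -\<epsilon> \<le> (1 / 2) powr -\<epsilon>"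
          using True t assms by (intro powr_mono2') auto
        also have "\<dots> = 2 powr \<epsilon>" by (simp add: powr_divide powr_minus_divide)
        finally have 1: "(1 - t) powr -\<epsilon> \<le> 2 powr \<epsilon>" .
        have 2: "1 / (1 - \<rho> * t) \<le> 2"
          using True t \<rho>t by (simp add: divide_simps)
        have "(1 - t) powr -\<epsilon> * (1 / (1 - \<rho> * t)) \<le> 2 powr \<epsilon> * 2"
          using 1 2 t \<rho>t by (intro mult_mono) auto
        then have "t powr \<beta> * ((1 - t) powr -\<epsilon> * (1 / (1 - \<rho> * t))) \<le> t powr \<beta> * (2 powr \<epsilon> * 2)"
          by (intro mult_left_mono) auto
        with nn t show ?thesis by (auto simp: mult_ac)
      next
        case False
        have 1: "t powr \<beta> \<le> c"
        proof (cases "\<beta> \<ge> 0")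
          case True
          then show ?thesis using t powr_le1[of \<beta> t] by (auto simp: c_def)
        next
          case neg: False
          have "t powr \<beta> \<le> (1 / 2) powr \<beta>"
            using neg t False by (intro powr_mono2') auto
          also have "\<dots> = 2 powr -\<beta>" by (simp add: powr_divide powr_minus_divide)
          finally show ?thesis by (simp add: c_def)
        qed
        \<comment> \<open>Here \<open>t > 1 / 2\<close> enters; for small \<open>t\<close> this
          comparison fails.\<close>
        have "(1 - \<rho>) \<le> (1 - \<rho>) * (2 * t)"
          using False \<rho> by (intro mult_right_le_one_le[THEN order_trans] mult_le_cancel_left1[THEN iffD2]) auto
        then have "(1 - t) + (1 - \<rho>) \<le> 2 * (1 - \<rho> * t)"
          using t by (simp add: algebra_simps)
        then have 2: "1 / (1 - \<rho> * t) \<le> 2 / ((1 - t) + (1 - \<rho>))"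
          using t \<rho> \<rho>t by (simp add: divide_simps)
        have "t powr \<beta> * (1 / (1 - \<rho> * t)) \<le> c * (2 / ((1 - t) + (1 - \<rho>)))"
          using 1 2 t \<rho>t c by (intro mult_mono) auto
        then have "(1 - t) powr -\<epsilon> * (t powr \<beta> * (1 / (1 - \<rho> * t)))
            \<le> (1 - t) powr -\<epsilon> * (c * (2 / ((1 - t) + (1 - \<rho>))))"
          by (intro mult_left_mono) auto
        then show ?thesis using t by (auto simp: mult_ac intro: add_increasing)
      qed
    qed (use assms c \<rho> in \<open>auto simp: indicator_def\<close>)
    have "(\<integral>\<^sup>+t. ennreal (t powr \<beta> * (1 - t) powr -\<epsilon> / (1 - \<rho> * t) * indicator {0..<1} t) \<partial>lborel)
      \<le> (\<integral>\<^sup>+t. ennreal (2 powr \<epsilon> * 2) * ennreal (t powr \<beta> * indicator {0..1} t)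
         + ennreal (2 * c) * ennreal ((1 - t) powr -\<epsilon> / ((1 - t) + (1 - \<rho>)) * indicator {0..} (1 - t)) \<partial>lborel)"
    proof (rule nn_integral_mono)
      fix t :: real
      have nn: "0 \<le> (1 - t) powr -\<epsilon> / ((1 - t) + (1 - \<rho>)) * indicator {0..} (1 - t)"
        using \<rho> by (auto simp: indicator_def)
      show "ennreal (t powr \<beta> * (1 - t) powr -\<epsilon> / (1 - \<rho> * t) * indicator {0..<1} t)
         \<le> ennreal (2 powr \<epsilon> * 2) * ennreal (t powr \<beta> * indicator {0..1} t)
         + ennreal (2 * c) * ennreal ((1 - t) powr -\<epsilon> / ((1 - t) + (1 - \<rho>)) * indicator {0..} (1 - t))"
        using ennreal_leI[OF pw[of t]] nn c by (subst (asm) ennreal_lincomb) auto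
    qed
    also have "\<dots> = ennreal (2 powr \<epsilon> * 2) * (\<integral>\<^sup>+t. ennreal (t powr \<beta> * indicator {0..1} t) \<partial>lborel)
       + ennreal (2 * c) * (\<integral>\<^sup>+t. ennreal ((1 - t) powr -\<epsilon> / ((1 - t) + (1 - \<rho>)) * indicator {0..} (1 - t)) \<partial>lborel)"
      by (simp add: nn_integral_add nn_integral_cmult)
    also have "(\<integral>\<^sup>+t. ennreal (t powr \<beta> * indicator {0..1} t) \<partial>lborel) = ennreal (1 / (\<beta> + 1))"
      using assms by (subst nn_integral_powr_from_0) auto
    \<comment> \<open>The reflection of \<open>t\<close> to \<open>1 - t\<close> moves the
      singularity to the origin, with \<open>\<delta> = 1 - \<rho>\<close>.\<close>
    also have "(\<integral>\<^sup>+t. ennreal ((1 - t) powr -\<epsilon> / ((1 - t) + (1 - \<rho>)) * indicator {0..} (1 - t)) \<partial>lborel)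
        = (\<integral>\<^sup>+t. ennreal (t powr -\<epsilon> / (t + (1 - \<rho>)) * indicator {0..} t) \<partial>lborel)"
      using nn_integral_real_affine
        [of "\<lambda>t. ennreal (t powr -\<epsilon> / (t + (1 - \<rho>)) * indicator {0..} t)" "-1" 1]
      by simp
    also have "ennreal (2 powr \<epsilon> * 2) * ennreal (1 / (\<beta> + 1)) + ennreal (2 * c) * \<dots>
        \<le> ennreal (2 powr \<epsilon> * 2) * ennreal (1 / (\<beta> + 1)) + ennreal (2 * c) * ennreal (D * (1 - \<rho>) powr -\<epsilon>)"
      unfolding D_def using assms \<rho>
      by (intro add_left_mono mult_left_mono nn_integral_powr_div_add_le) auto
    also have "\<dots> = ennreal (2 powr \<epsilon> * 2 * (1 / (\<beta> + 1)) + 2 * c * (D * (1 - \<rho>) powr -\<epsilon>))"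
      using assms c D by (subst ennreal_lincomb) auto
    also have "\<dots> \<le> ennreal (C * (1 - \<rho>) powr -\<epsilon>)"
    proof (rule ennreal_leI)
      have "(1 - \<rho>) powr -\<epsilon> \<ge> 1 powr -\<epsilon>"
        using \<rho> assms by (intro powr_mono2') auto
      then have "2 powr \<epsilon> * 2 * (1 / (\<beta> + 1)) * 1 \<le> 2 powr \<epsilon> * 2 * (1 / (\<beta> + 1)) * (1 - \<rho>) powr -\<epsilon>"
        using assms by (intro mult_left_mono) auto
      then show "2 powr \<epsilon> * 2 * (1 / (\<beta> + 1)) + 2 * c * (D * (1 - \<rho>) powr -\<epsilon>) \<le> C * (1 - \<rho>) powr -\<epsilon>"
        by (simp add: C_def algebra_simps)
    qed
    finally show ?thesis .
  qed
  with C that show ?thesis by blast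
qed

text \<open>Up to the factor \<open>1 - norm a ^ 2\<close> the integrand is the real part of
  \<open>(1 + a u\<^sup>m) / (1 - a u\<^sup>m)\<close> on the unit circle, whose mean is its value at \<open>0\<close>.\<close>

lemma has_integral_Poisson_kernel:
  fixes a :: complex and m :: nat
  assumes a: "norm a < 1" and m: "m > 0"
  shows "((\<lambda>\<theta>. 1 / (norm (1 - a * exp (2 * of_real pi * \<i> * of_real \<theta>) ^ m))\<^sup>2)
      has_integral 1 / (1 - (norm a)\<^sup>2)) {0..1}"
proof -
  define e where "e \<theta> = exp (2 * of_real pi * \<i> * of_real \<theta>)" for \<theta> :: real
  define f where "f u = (1 + a * u ^ m) / (1 - a * u ^ m)" for u
  have nz: "1 - a * u ^ m \<noteq> 0" if "norm u \<le> 1" for u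
  proof
    assume "1 - a * u ^ m = 0"
    then have "norm (a * u ^ m) = 1" by simp
    moreover have "norm (a * u ^ m) \<le> norm a * 1"
      unfolding norm_mult norm_power using that by (intro mult_left_mono power_le_one) auto
    ultimately show False using a by simp
  qed
  \<comment> \<open>On the circle the form du/u is a constant multiple of the angular measure, so
    Cauchy's formula at the centre becomes a mean value; \<open>m > 0\<close> makes
    \<open>f 0 = 1\<close>.\<close>
  have "((\<lambda>u. f u / (u - 0)) has_contour_integral 2 * of_real pi * \<i> * f 0) (circlepath 0 1)"
  proof (rule Cauchy_integral_circlepath)
    show "continuous_on (cball 0 1) f"
      unfolding f_def using nz by (intro continuous_intros) auto
    show "f holomorphic_on ball 0 1"
      unfolding f_def using nz by (intro holomorphic_intros) auto
  qed auto
  then have "((\<lambda>\<theta>. f (e \<theta>) / e \<theta> * (2 * of_real pi * \<i> * e \<theta>)) has_integral 2 * of_real pi * \<i> * f 0) {0..1}"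
    unfolding has_contour_integral_def
  proof (rule has_integral_eq[rotated])
    fix \<theta> :: real
    assume \<theta>: "\<theta> \<in> {0..1}"
    have "circlepath 0 1 \<theta> = e \<theta>" by (simp add: circlepath e_def)
    with \<theta> show "f (circlepath 0 1 \<theta>) / (circlepath 0 1 \<theta> - 0) * vector_derivative (circlepath 0 1) (at \<theta> within {0..1})
        = f (e \<theta>) / e \<theta> * (2 * of_real pi * \<i> * e \<theta>)"
      by (simp add: vector_derivative_circlepath01 e_def)
  qed
  moreover define K where "K = 2 * of_real pi * \<i>"
  ultimately have "((\<lambda>\<theta>. 1 / K * (f (e \<theta>) / e \<theta> * (K * e \<theta>))) has_integral 1 / K * (K * f 0)) {0..1}"
    by (intro has_integral_mult_right) simp
  moreover have "K \<noteq> 0" "e \<theta> \<noteq> 0" for \<theta>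
    by (simp_all add: K_def e_def)
  ultimately have "((\<lambda>\<theta>. f (e \<theta>)) has_integral 1) {0..1}"
    using m by (simp add: f_def zero_power)
  then have "((\<lambda>\<theta>. Re (f (e \<theta>))) has_integral 1) {0..1}"
    using has_integral_Re by force
  then have "((\<lambda>\<theta>. 1 / (1 - (norm a)\<^sup>2) * Re (f (e \<theta>))) has_integral 1 / (1 - (norm a)\<^sup>2) * 1) {0..1}"
    by (rule has_integral_mult_right)
  moreover have "1 / (1 - (norm a)\<^sup>2) * Re (f (e \<theta>)) = 1 / (norm (1 - a * e \<theta> ^ m))\<^sup>2" for \<theta>
  proof -
    define b where "b = a * e \<theta> ^ m"
    have e1: "norm (e \<theta>) = 1" by (simp add: e_def norm_exp_eq_Re)
    then have nb: "norm b = norm a" by (simp add: b_def norm_mult norm_power)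
    have b: "1 - b \<noteq> 0" using nz[of "e \<theta>"] e1 by (simp add: b_def)
    have "f (e \<theta>) = (1 + b) / (1 - b)" by (simp add: f_def b_def)
    also have "\<dots> = (1 + b) * cnj (1 - b) / of_real ((norm (1 - b))\<^sup>2)"
      by (rule complex_div_cnj)
    also have "Re \<dots> = Re ((1 + b) * cnj (1 - b)) / (norm (1 - b))\<^sup>2"
      by (simp only: Re_divide_of_real)
    \<comment> \<open>The cross terms \<open>b - cnj b\<close> are purely imaginary.\<close>
    also have "Re ((1 + b) * cnj (1 - b)) = 1 - (norm b)\<^sup>2"
      unfolding cmod_power2 by (simp add: power2_eq_square algebra_simps)
    finally have "Re (f (e \<theta>)) = (1 - (norm a)\<^sup>2) / (norm (1 - b))\<^sup>2" by (simp add: nb)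
    moreover have "1 - (norm a)\<^sup>2 \<noteq> 0"
      using a power_less_one_iff[of "norm a" 2] by auto
    ultimately show ?thesis by (simp add: b_def)
  qed
  ultimately show ?thesis by (simp add: e_def)
qed

section \<open>Averages over rotations and the estimate on the disc\<close>

lemma nn_integral_Poisson_kernel:
  fixes a :: complex and m :: nat
  assumes a: "norm a < 1" and m: "m > 0"
  shows "(\<integral>\<^sup>+\<theta>. indicator {0..1} \<theta> *
      ennreal (1 / (norm (1 - a * exp (2 * of_real pi * \<i> * of_real \<theta>) ^ m))\<^sup>2) \<partial>lborel)
      = ennreal (1 / (1 - (norm a)\<^sup>2))"
proof -
  let ?f = "\<lambda>\<theta>. 1 / (norm (1 - a * exp (2 * of_real pi * \<i> * of_real \<theta>) ^ m))\<^sup>2"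
  have [measurable]: "(\<lambda>\<theta>::real. exp (2 * of_real pi * \<i> * of_real \<theta>) :: complex) \<in> borel_measurable borel"
    by (intro borel_measurable_continuous_onI continuous_intros)
  have "(\<integral>\<^sup>+\<theta>. ennreal (indicator {0..1} \<theta> * ?f \<theta>) \<partial>lborel) = ennreal (1 / (1 - (norm a)\<^sup>2))"
  proof (rule nn_integral_has_integral_lborel)
    have "((\<lambda>\<theta>. if \<theta> \<in> {0..1} then ?f \<theta> else 0) has_integral 1 / (1 - (norm a)\<^sup>2)) UNIV"
      using has_integral_Poisson_kernel[OF assms] by (simp only: has_integral_restrict_UNIV)
    then show "((\<lambda>\<theta>. indicator {0..1} \<theta> * ?f \<theta>) has_integral 1 / (1 - (norm a)\<^sup>2)) UNIV"
      by (rule has_integral_eq_rhs[OF has_integral_eq, rotated]) (auto simp: indicator_def)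
  qed auto
  moreover have "indicator {0..1} \<theta> * ennreal (?f \<theta>) = ennreal (indicator {0..1} \<theta> * ?f \<theta>)" for \<theta>
    by (auto simp: indicator_def)
  ultimately show ?thesis by (simp only:)
qed

text \<open>The integral is unchanged when \<open>z\<close> is rotated, hence equal to its mean over
  all rotations. Tonelli moves the mean inside, where the Poisson integral applies with parameter
  \<open>c * z ^ m\<close>. Since \<open>G\<close> vanishes from 1 on, only points with
  \<open>norm z < 1\<close> count, and there the parameter lies in the open disc.\<close>

lemma nn_integral_disc_average:
  fixes G :: "real \<Rightarrow> ennreal" and c :: complex
  assumes [measurable]: "G \<in> borel_measurable borel" and G: "\<And>t. t \<ge> 1 \<Longrightarrow> G t = 0"
    and c: "norm c < 1" and m: "m > 0"
  shows "(\<integral>\<^sup>+z. G ((norm z)\<^sup>2) * ennreal (1 / (norm (1 - c * z ^ m))\<^sup>2) \<partial>lborel)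
       = (\<integral>\<^sup>+(z::complex). G ((norm z)\<^sup>2) * ennreal (1 / (1 - (norm c)\<^sup>2 * ((norm z)\<^sup>2) ^ m)) \<partial>lborel)"
proof -
  define e where "e \<theta> = exp (2 * of_real pi * \<i> * of_real \<theta>)" for \<theta> :: real
  define F where "F z = G ((norm z)\<^sup>2) * ennreal (1 / (norm (1 - c * z ^ m))\<^sup>2)" for z
  have [measurable]: "e \<in> borel_measurable borel"
    unfolding e_def[abs_def] by (intro borel_measurable_continuous_onI continuous_intros)
  have [measurable]: "F \<in> borel_measurable borel"
    unfolding F_def[abs_def] by measurable
  have e: "norm (e \<theta>) = 1" for \<theta> by (simp add: e_def norm_exp_eq_Re)
  \<comment> \<open>The angle runs over an interval of mass 1, so this inserts an average.\<close>
  have "(\<integral>\<^sup>+z. F z \<partial>lborel) = (\<integral>\<^sup>+\<theta>. indicator {0..1} \<theta> * (\<integral>\<^sup>+z. F z \<partial>lborel) \<partial>(lborel :: real measure))"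
    by (simp add: nn_integral_multc)
  also have "\<dots> = (\<integral>\<^sup>+\<theta>. (\<integral>\<^sup>+z. indicator {0..1} \<theta> * F (e \<theta> * z) \<partial>lborel) \<partial>(lborel :: real measure))"
    by (simp add: nn_integral_cmult nn_integral_complex_rotate e)
  also have "\<dots> = (\<integral>\<^sup>+z. (\<integral>\<^sup>+\<theta>. indicator {0..1} \<theta> * F (e \<theta> * z) \<partial>(lborel :: real measure)) \<partial>lborel)"
    by (rule lborel_pair.Fubini') measurable
  also have "\<dots> = (\<integral>\<^sup>+(z::complex). G ((norm z)\<^sup>2) * ennreal (1 / (1 - (norm c)\<^sup>2 * ((norm z)\<^sup>2) ^ m)) \<partial>lborel)"
  proof (rule nn_integral_cong)
    fix z :: complex
    have "(\<integral>\<^sup>+\<theta>. indicator {0..1} \<theta> * F (e \<theta> * z) \<partial>lborel)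
       = (\<integral>\<^sup>+\<theta>. G ((norm z)\<^sup>2) * (indicator {0..1} \<theta> * ennreal (1 / (norm (1 - (c * z ^ m) * e \<theta> ^ m))\<^sup>2)) \<partial>lborel)"
      by (simp add: F_def norm_mult e power_mult_distrib mult_ac)
    also have "\<dots> = G ((norm z)\<^sup>2) * (\<integral>\<^sup>+\<theta>. indicator {0..1} \<theta> * ennreal (1 / (norm (1 - (c * z ^ m) * e \<theta> ^ m))\<^sup>2) \<partial>lborel)"
      by (rule nn_integral_cmult) measurable
    also have "\<dots> = G ((norm z)\<^sup>2) * ennreal (1 / (1 - (norm c)\<^sup>2 * ((norm z)\<^sup>2) ^ m))"
    proof (cases "norm z < 1")
      case True
      have "norm (c * z ^ m) \<le> norm c * 1"
        unfolding norm_mult norm_power using True by (intro mult_left_mono power_le_one) auto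
      then have "norm (c * z ^ m) < 1" using c by simp
      from nn_integral_Poisson_kernel[OF this m] show ?thesis
        by (simp add: e_def norm_mult norm_power power_mult_distrib flip: power_mult) 
           (simp add: mult.commute)
    next
      case False
      then have "G ((norm z)\<^sup>2) = 0" by (intro G) (simp add: one_le_power)
      then show ?thesis by simp
    qed
    finally show "(\<integral>\<^sup>+\<theta>. indicator {0..1} \<theta> * F (e \<theta> * z) \<partial>lborel)
       = G ((norm z)\<^sup>2) * ennreal (1 / (1 - (norm c)\<^sup>2 * ((norm z)\<^sup>2) ^ m))" .
  qed
  finally show ?thesis by (simp add: F_def)
qed

text \<open>After averaging, the square of the modulus is the only variable and
  \<open>b > -2\<close> becomes the integrability of \<open>t powr (b / 2)\<close> at 0. On
  \<open>[0, 1)\<close> one has \<open>t ^ m \<le> t\<close>, so replacing \<open>t ^ m\<close> by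
  \<open>t\<close> enlarges both the weight and the reciprocal of the denominator and reduces the
  claim to the one-dimensional estimate with \<open>\<rho> = (norm c)\<^sup>2\<close>.\<close>

lemma nn_integral_disc_kernel_le:
  fixes b \<epsilon> :: real and m :: nat
  assumes b: "b > -2" and \<epsilon>: "0 < \<epsilon>" "\<epsilon> < 1" and m: "m > 0"
  obtains C where "C \<ge> 0"
    "\<And>c. norm (c::complex) < 1 \<Longrightarrow>
      (\<integral>\<^sup>+z. indicator (ball 0 1) z *
         ennreal (norm z powr b * (1 - (norm z)\<^sup>2 ^ m) powr -\<epsilon> / (norm (1 - c * z ^ m))\<^sup>2) \<partial>lborel)
        \<le> ennreal (C * (1 - (norm c)\<^sup>2) powr -\<epsilon>)"
proof -
  from b have "b / 2 > -1" by simp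
  from nn_integral_powr_kernel_le[OF this \<epsilon>] obtain C where C: "C \<ge> 0"
    "\<And>\<rho>. 0 \<le> \<rho> \<Longrightarrow> \<rho> < 1 \<Longrightarrow>
      (\<integral>\<^sup>+t. ennreal (t powr (b / 2) * (1 - t) powr -\<epsilon> / (1 - \<rho> * t) * indicator {0..<1} t) \<partial>lborel)
        \<le> ennreal (C * (1 - \<rho>) powr -\<epsilon>)" by blast
  have "(\<integral>\<^sup>+z. indicator (ball 0 1) z *
         ennreal (norm z powr b * (1 - (norm z)\<^sup>2 ^ m) powr -\<epsilon> / (norm (1 - c * z ^ m))\<^sup>2) \<partial>lborel)
        \<le> ennreal (pi * C * (1 - (norm c)\<^sup>2) powr -\<epsilon>)" if c: "norm c < 1" for c :: complex
  proof -
    define G where "G t = ennreal (t powr (b / 2) * (1 - t ^ m) powr -\<epsilon>) * indicator {0..<1} t" for t :: real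
    have [measurable]: "G \<in> borel_measurable borel" unfolding G_def[abs_def] by measurable
    have c2: "(norm c)\<^sup>2 < 1" using c by (simp add: power_less_one_iff)
    have ct: "(norm c)\<^sup>2 * t \<le> (norm c)\<^sup>2" if "0 \<le> t" "t \<le> 1" for t
      using that by (simp add: mult_left_le)
    have "indicator (ball 0 1) z *
         ennreal (norm z powr b * (1 - (norm z)\<^sup>2 ^ m) powr -\<epsilon> / (norm (1 - c * z ^ m))\<^sup>2)
       = G ((norm z)\<^sup>2) * ennreal (1 / (norm (1 - c * z ^ m))\<^sup>2)" for z :: complex
    proof (cases "norm z < 1")
      case True
      then have "(norm z)\<^sup>2 < 1" by (simp add: power_less_one_iff)
      moreover have "(norm z)\<^sup>2 powr (b / 2) = norm z powr b"
        by (cases "z = 0") (simp_all add: powr_powr flip: powr_numeral)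
      ultimately show ?thesis
        using True by (simp add: G_def flip: ennreal_mult')
    next
      case False
      then have "1 \<le> (norm z)\<^sup>2" by (simp add: one_le_power)
      then have "indicator {0..<1} ((norm z)\<^sup>2) = (0 :: ennreal)"
        by (metis atLeastLessThan_iff indicator_simps(2) not_less)
      with False show ?thesis by (simp add: G_def)
    qed
    then have "(\<integral>\<^sup>+z. indicator (ball 0 1) z *
         ennreal (norm z powr b * (1 - (norm z)\<^sup>2 ^ m) powr -\<epsilon> / (norm (1 - c * z ^ m))\<^sup>2) \<partial>lborel)
       = (\<integral>\<^sup>+z. G ((norm z)\<^sup>2) * ennreal (1 / (norm (1 - c * z ^ m))\<^sup>2) \<partial>lborel)"
      by simp
    also have "\<dots> = (\<integral>\<^sup>+(z::complex). G ((norm z)\<^sup>2) * ennreal (1 / (1 - (norm c)\<^sup>2 * ((norm z)\<^sup>2) ^ m)) \<partial>lborel)"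
      by (rule nn_integral_disc_average) (use c m in \<open>auto simp: G_def\<close>)
    also have "\<dots> = ennreal pi * (\<integral>\<^sup>+t. G t * ennreal (1 / (1 - (norm c)\<^sup>2 * t ^ m)) * indicator {0..} t \<partial>lborel)"
      by (rule nn_integral_radial) measurable
    also have "\<dots> \<le> ennreal pi * (\<integral>\<^sup>+t. ennreal (t powr (b / 2) * (1 - t) powr -\<epsilon> / (1 - (norm c)\<^sup>2 * t) * indicator {0..<1} t) \<partial>lborel)"
    proof (intro mult_left_mono nn_integral_mono)
      fix t :: real
      show "G t * ennreal (1 / (1 - (norm c)\<^sup>2 * t ^ m)) * indicator {0..} t
        \<le> ennreal (t powr (b / 2) * (1 - t) powr -\<epsilon> / (1 - (norm c)\<^sup>2 * t) * indicator {0..<1} t)"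
      proof (cases "0 \<le> t \<and> t < 1")
        case t: True
        have tm: "t ^ m \<le> t" using t m power_decreasing[of 1 m t] by simp
        have "(1 - t ^ m) powr -\<epsilon> \<le> (1 - t) powr -\<epsilon>"
          using t tm \<epsilon> by (intro powr_mono2') auto
        moreover have "1 / (1 - (norm c)\<^sup>2 * t ^ m) \<le> 1 / (1 - (norm c)\<^sup>2 * t)"
          using ct[of t] c2 t tm mult_left_mono[OF tm, of "(norm c)\<^sup>2"] by (intro divide_left_mono mult_pos_pos) auto
        ultimately have "(1 - t ^ m) powr -\<epsilon> * (1 / (1 - (norm c)\<^sup>2 * t ^ m))
            \<le> (1 - t) powr -\<epsilon> * (1 / (1 - (norm c)\<^sup>2 * t))"
          using ct[of "t ^ m"] c2 t by (intro mult_mono) (auto simp: power_le_one)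
        then have "t powr (b / 2) * ((1 - t ^ m) powr -\<epsilon> * (1 / (1 - (norm c)\<^sup>2 * t ^ m)))
            \<le> t powr (b / 2) * ((1 - t) powr -\<epsilon> * (1 / (1 - (norm c)\<^sup>2 * t)))"
          by (intro mult_left_mono) auto
        from ennreal_leI[OF this] t show ?thesis by (simp add: G_def mult.assoc flip: ennreal_mult')
      qed (auto simp: G_def)
    qed auto
    also have "\<dots> \<le> ennreal pi * ennreal (C * (1 - (norm c)\<^sup>2) powr -\<epsilon>)"
      using c2 by (intro mult_left_mono C) auto
    also have "\<dots> = ennreal (pi * C * (1 - (norm c)\<^sup>2) powr -\<epsilon>)"
      using C(1) by (simp add: mult.assoc flip: ennreal_mult')
    finally show ?thesis .
  qed
  with C(1) that[of "pi * C"] show ?thesis by simp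
qed

section \<open>Monomials on the Hartogs triangle\<close>

lemma hartogs_borel[measurable]: "hartogs m n \<in> sets borel"
proof -
  have "hartogs m n = {z. norm (fst z) powr (real m / real n) < norm (snd z) \<and> norm (snd z) < 1}"
    by (auto simp: hartogs_def)
  also have "\<dots> \<in> sets (borel :: (complex \<times> complex) measure)"
  proof -
    have "Measurable.pred (borel \<Otimes>\<^sub>M borel) (\<lambda>z :: complex \<times> complex.
        norm (fst z) powr (real m / real n) < norm (snd z) \<and> norm (snd z) < 1)"
      by measurable
    then show ?thesis by (simp add: borel_prod pred_def)
  qed
  finally show ?thesis .
qed

text \<open>For Borel integrands the completed measure gives the same integral as
  \<open>lborel\<close>, to which Tonelli applies. The first coordinate is integrated innermost,
  since the slices over a fixed second coordinate are discs.\<close>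

lemma nn_integral_dV:
  fixes F :: "complex \<times> complex \<Rightarrow> ennreal"
  assumes [measurable]: "F \<in> borel_measurable borel"
  shows "(\<integral>\<^sup>+z. F z \<partial>dV m n) = (\<integral>\<^sup>+w. \<integral>\<^sup>+v. F (v, w) * indicator (hartogs m n) (v, w) \<partial>lborel \<partial>lborel)"
proof -
  have "(\<integral>\<^sup>+z. F z \<partial>dV m n) = (\<integral>\<^sup>+z. F z * indicator (hartogs m n) z \<partial>lebesgue)"
    by (rule nn_integral_restrict_space) simp
  also have "\<dots> = (\<integral>\<^sup>+z. F z * indicator (hartogs m n) z \<partial>lborel)"
    by (rule nn_integral_completion)
  also have "\<dots> = (\<integral>\<^sup>+z. F z * indicator (hartogs m n) z \<partial>(lborel \<Otimes>\<^sub>M lborel))"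
    by (simp only: lborel_prod)
  also have "\<dots> = (\<integral>\<^sup>+w. \<integral>\<^sup>+v. F (v, w) * indicator (hartogs m n) (v, w) \<partial>lborel \<partial>lborel)"
  proof -
    have "(\<lambda>z. F z * indicator (hartogs m n) z) \<in> borel_measurable (lborel \<Otimes>\<^sub>M lborel)"
      unfolding lborel_prod by measurable
    from lborel_pair.nn_integral_snd[OF this] show ?thesis by simp
  qed
  finally show ?thesis .
qed

text \<open>The slice over \<open>w\<close> is the disc of radius
  \<open>norm w powr (n / m)\<close>, and scaling it to the unit disc has the square of this radius
  as real Jacobian. Over \<open>w = 0\<close> the slice is empty.\<close>

lemma nn_integral_hartogs:
  fixes F :: "complex \<times> complex \<Rightarrow> ennreal"
  assumes F[measurable]: "F \<in> borel_measurable borel" and m: "m > 0" and n: "n > 0"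
  shows "(\<integral>\<^sup>+z. F z \<partial>dV m n) = (\<integral>\<^sup>+w. indicator (ball 0 1 - {0}) w * (ennreal (norm w powr (2 * real n / real m)) *
     (\<integral>\<^sup>+v. indicator (ball 0 1) v * F (of_real (norm w powr (n / m)) * v, w) \<partial>lborel)) \<partial>lborel)"
  unfolding nn_integral_dV[OF F]
proof (rule nn_integral_cong)
  fix w :: complex
  define R where "R = norm w powr (n / m)"
  have [measurable]: "(\<lambda>v. F (v, w)) \<in> borel_measurable borel"
    "(\<lambda>v. indicator (hartogs m n) (v, w) :: ennreal) \<in> borel_measurable borel"
  proof -
    have *: "(\<lambda>v. (v, w)) \<in> borel \<rightarrow>\<^sub>M borel"
      by (intro borel_measurable_continuous_onI continuous_intros)
    from * show "(\<lambda>v. F (v, w)) \<in> borel_measurable borel" by measurable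
    from * show "(\<lambda>v. indicator (hartogs m n) (v, w) :: ennreal) \<in> borel_measurable borel" by measurable
  qed
  show "(\<integral>\<^sup>+v. F (v, w) * indicator (hartogs m n) (v, w) \<partial>lborel)
     = indicator (ball 0 1 - {0}) w * (ennreal (norm w powr (2 * real n / real m)) *
     (\<integral>\<^sup>+v. indicator (ball 0 1) v * F (of_real (norm w powr (n / m)) * v, w) \<partial>lborel))"
  proof (cases "w \<in> ball 0 1 - {0}")
    case True
    then have R: "R > 0" by (simp add: R_def)
    have Rm: "R powr (m / n) = norm w" using True m n by (simp add: R_def powr_powr)
    have R2: "R\<^sup>2 = norm w powr (2 * real n / real m)"
      using R by (simp add: R_def powr_powr flip: powr_numeral) (simp add: mult_ac)
    have ind: "indicator (hartogs m n) (of_real R * v, w) = (indicator (ball 0 1) v :: ennreal)" for v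
    proof -
      have "norm (of_real R * v) powr (m / n) = norm w * norm v powr (m / n)"
        using R by (simp add: norm_mult powr_mult Rm)
      moreover have "norm v powr (m / n) < 1 \<longleftrightarrow> norm v < 1"
        using m n powr_less_mono2[of "m / n" "norm v" 1] ge_one_powr_ge_zero[of "norm v" "m / n"]
        by (cases "norm v < 1") (simp_all add: not_less)
      ultimately show ?thesis using True by (auto simp: hartogs_def indicator_def)
    qed
    have "(\<integral>\<^sup>+v. F (v, w) * indicator (hartogs m n) (v, w) \<partial>lborel)
      = ennreal (R\<^sup>2) * (\<integral>\<^sup>+v. F (of_real R * v, w) * indicator (hartogs m n) (of_real R * v, w) \<partial>lborel)"
      by (rule nn_integral_complex_scale) (use R in measurable)
    then show ?thesis unfolding ind using True by (simp add: R2 mult.commute flip: R_def)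
  next
    case False
    then have "(v, w) \<notin> hartogs m n" for v
      using powr_ge_zero[of "norm v" "m / n"] by (auto simp: hartogs_def not_less simp del: powr_ge_zero)
    with False show ?thesis by simp
  qed
qed

section \<open>Integrals and holomorphy of monomials\<close>

lemma nn_integral_disc_powr:
  fixes a :: real
  shows "(\<integral>\<^sup>+(z::complex). indicator (ball 0 1) z * ennreal (norm z powr a) \<partial>lborel)
      = (if a > -2 then ennreal (2 * pi / (a + 2)) else \<infinity>)"
proof -
  have "(\<integral>\<^sup>+(z::complex). indicator (ball 0 1) z * ennreal (norm z powr a) \<partial>lborel)
      = (\<integral>\<^sup>+(z::complex). indicator {0..<1} ((norm z)\<^sup>2) * ennreal (((norm z)\<^sup>2) powr (a / 2)) \<partial>lborel)"
  proof (rule nn_integral_cong)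
    fix z :: complex
    have "(norm z)\<^sup>2 powr (a / 2) = norm z powr a"
      by (cases "z = 0") (simp_all add: powr_powr flip: powr_numeral)
    moreover have "norm z < 1 \<longleftrightarrow> (norm z)\<^sup>2 < 1"
      using power_less_one_iff[of "norm z" 2] by simp
    ultimately show "indicator (ball 0 1) z * ennreal (norm z powr a)
       = indicator {0..<1} ((norm z)\<^sup>2) * ennreal (((norm z)\<^sup>2) powr (a / 2))"
      by (auto simp: indicator_def)
  qed
  also have "\<dots> = ennreal pi * (\<integral>\<^sup>+t. indicator {0..<1} t * ennreal (t powr (a / 2)) * indicator {0..} t \<partial>lborel)"
    by (rule nn_integral_radial) measurable
  also have "(\<integral>\<^sup>+t. indicator {0..<1} t * ennreal (t powr (a / 2)) * indicator {0..} t \<partial>lborel)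
     = (\<integral>\<^sup>+t. ennreal (t powr (a / 2) * indicator {0..1} t) \<partial>lborel)"
    using AE_lborel_singleton[of "1::real"]
    by (intro nn_integral_cong_AE) (auto elim!: eventually_mono simp: indicator_def)
  also have "ennreal pi * \<dots> = (if a > -2 then ennreal (2 * pi / (a + 2)) else \<infinity>)"
  proof (cases "a > -2")
    case True
    then have "(\<integral>\<^sup>+t. ennreal (t powr (a / 2) * indicator {0..1} t) \<partial>lborel) = ennreal (1 / (a / 2 + 1))"
      by (subst nn_integral_powr_from_0) auto
    moreover have "pi * (1 / (a / 2 + 1)) = 2 * pi / (a + 2)" using True by (simp add: field_simps)
    ultimately show ?thesis using True by (simp flip: ennreal_mult')
  next
    case False
    have "(\<integral>\<^sup>+t. ennreal (t powr (a / 2) * indicator {0..1} t) \<partial>lborel) = \<infinity>"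
    proof (rule ccontr)
      assume "\<not> ?thesis"
      then obtain I where I: "I \<ge> 0" "(\<integral>\<^sup>+t. ennreal (t powr (a / 2) * indicator {0..1} t) \<partial>lborel) = ennreal I"
        by (cases "(\<integral>\<^sup>+t. ennreal (t powr (a / 2) * indicator {0..1} t) \<partial>lborel)") auto
      text \<open>Compare with \<open>t powr (\<eta> - 1)\<close>, whose integral is \<open>1 / \<eta>\<close>.\<close>
      define \<eta> where "\<eta> = 1 / (I + 1)"
      have \<eta>: "\<eta> > 0" using I(1) by (simp add: \<eta>_def)
      have "ennreal (1 powr (\<eta> - 1 + 1) / (\<eta> - 1 + 1)) = (\<integral>\<^sup>+t. ennreal (t powr (\<eta> - 1) * indicator {0..1} t) \<partial>lborel)"
        using \<eta> by (subst nn_integral_powr_from_0) auto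
      also have "\<dots> \<le> (\<integral>\<^sup>+t. ennreal (t powr (a / 2) * indicator {0..1} t) \<partial>lborel)"
      proof (intro nn_integral_mono ennreal_leI)
        fix t :: real
        show "t powr (\<eta> - 1) * indicator {0..1} t \<le> t powr (a / 2) * indicator {0..1} t"
          using False \<eta> by (cases "0 < t \<and> t \<le> 1") (auto simp: indicator_def intro!: powr_mono')
      qed
      \<comment> \<open>The comparison has produced \<open>I + 1 \<le> I\<close>.\<close>
      finally show False using I(1) by (simp add: I(2) \<eta>_def)
    qed
    with False show ?thesis by (simp add: ennreal_mult_top)
  qed
  finally show ?thesis .
qed

lemma nn_integral_cmult_disc_powr:
  fixes a :: real and K :: ennreal
  shows "(\<integral>\<^sup>+(z::complex). K * (indicator (ball 0 1) z * ennreal (norm z powr a)) \<partial>lborel)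
      = K * (if a > -2 then ennreal (2 * pi / (a + 2)) else \<infinity>)"
  proof -
  have "(\<lambda>z::complex. indicator (ball 0 1) z * ennreal (norm z powr a)) \<in> borel_measurable borel"
    by (intro borel_measurable_times_ennreal borel_measurable_indicator) auto
  then show ?thesis
    unfolding nn_integral_disc_powr[symmetric] by (intro nn_integral_cmult) simp
qed

lemma powr_power_int:
  fixes x p :: real and k :: int
  assumes "x > 0"
  shows "(x powi k) powr p = x powr (p * k)"
  using assms by (simp add: powr_powr mult.commute flip: powr_real_of_int')

lemma monomial_borel[measurable]: "monomial \<alpha> \<in> borel_measurable borel"
proof -
  have pi: "(\<lambda>x::complex. x powi k) \<in> borel_measurable borel" for k
    unfolding power_int_def by measurable
  have "(\<lambda>z. fst z powi fst \<alpha> * snd z powi snd \<alpha>) \<in> borel_measurable (borel :: (complex \<times> complex) measure)"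
    unfolding borel_prod[symmetric]
    by (intro borel_measurable_times measurable_compose[OF measurable_fst pi] measurable_compose[OF measurable_snd pi])
  then show ?thesis by (simp add: monomial_def[abs_def])
qed

text \<open>In the variables \<open>v\<close> and \<open>w\<close> the integrand separates into
  powers of \<open>norm v\<close> and \<open>norm w\<close>. The first always converges as
  \<open>i \<ge> 0\<close>; the second converges exactly when its exponent exceeds -2, which after
  multiplication by \<open>m\<close> is the stated inequality.\<close>

lemma nn_integral_monomial:
  fixes i j :: int and p :: real
  assumes m: "m > 0" and n: "n > 0" and i: "i \<ge> 0" and p: "p > 0"
  shows "(\<integral>\<^sup>+z. ennreal (norm (monomial (i, j) z) powr p) \<partial>dV m n)
    = (if p * of_int (n * i + m * j) + 2 * real m + 2 * real n > 0
       then ennreal (2 * pi / (p * i + 2) * (2 * pi * m / (p * of_int (n * i + m * j) + 2 * real m + 2 * real n))) else \<infinity>)"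
proof -
  \<comment> \<open>The total exponent of \<open>norm w\<close>: \<open>p * j\<close> from the
    second factor, \<open>(n / m) * (p * i)\<close> from the rescaled first factor, and
    \<open>2 n / m\<close> from the Jacobian.\<close>
  define c where "c = p * j + (n / m) * (p * i + 2)"
  have c: "c + 2 = (p * of_int (n * i + m * j) + 2 * real m + 2 * real n) / m"
    using m by (simp add: c_def field_simps)
  have [measurable]: "(\<lambda>z. ennreal (norm (monomial (i, j) z) powr p)) \<in> borel_measurable borel" by measurable
  have pi: "p * i > -2" using p i by (smt (verit) mult_nonneg_nonneg of_int_nonneg)
  have "(\<integral>\<^sup>+z. ennreal (norm (monomial (i, j) z) powr p) \<partial>dV m n)
     = (\<integral>\<^sup>+w. indicator (ball 0 1 - {0}) w * (ennreal (norm w powr (2 * real n / real m)) *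
     (\<integral>\<^sup>+v. indicator (ball 0 1) v * ennreal (norm (monomial (i, j) (of_real (norm w powr (n / m)) * v, w)) powr p) \<partial>lborel)) \<partial>lborel)"
    by (rule nn_integral_hartogs[OF _ m n, where F = "\<lambda>z. ennreal (norm (monomial (i, j) z) powr p)"]) measurable
  also have "\<dots> = (\<integral>\<^sup>+(w::complex). ennreal (2 * pi / (p * i + 2)) * (indicator (ball 0 1) w * ennreal (norm w powr c)) \<partial>lborel)"
  proof (rule nn_integral_cong)
    fix w :: complex
    show "indicator (ball 0 1 - {0}) w * (ennreal (norm w powr (2 * real n / real m)) *
     (\<integral>\<^sup>+v. indicator (ball 0 1) v * ennreal (norm (monomial (i, j) (of_real (norm w powr (n / m)) * v, w)) powr p) \<partial>lborel))
     = ennreal (2 * pi / (p * i + 2)) * (indicator (ball 0 1) w * ennreal (norm w powr c))"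
    proof (cases "w \<in> ball 0 1 - {0}")
      case True
      then have w: "norm w > 0" by simp
      have "(\<integral>\<^sup>+v. indicator (ball 0 1) v * ennreal (norm (monomial (i, j) (of_real (norm w powr (n / m)) * v, w)) powr p) \<partial>lborel)
        = (\<integral>\<^sup>+(v::complex). ennreal (norm w powr (p * j + (n / m) * (p * i))) * (indicator (ball 0 1) v * ennreal (norm v powr (p * i))) \<partial>lborel)"
      \<comment> \<open>The point \<open>v = 0\<close> has to be discarded: for \<open>i = 0\<close>
        the left side is positive there, whereas \<open>0 powr 0 = 0\<close>.\<close>
      proof (rule nn_integral_cong_AE, rule eventually_mono[OF AE_lborel_singleton[of "0::complex"]])
        fix v :: complex
        assume v: "v \<noteq> 0"
        have "norm (monomial (i, j) (of_real (norm w powr (n / m)) * v, w)) powr p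
           = norm w powr (p * j + (n / m) * (p * i)) * norm v powr (p * i)"
          using v w by (simp add: monomial_def norm_mult norm_power_int powr_mult powr_power_int
               powr_powr powr_add mult_ac)
        then show "indicator (ball 0 1) v * ennreal (norm (monomial (i, j) (of_real (norm w powr (n / m)) * v, w)) powr p)
          = ennreal (norm w powr (p * j + (n / m) * (p * i))) * (indicator (ball 0 1) v * ennreal (norm v powr (p * i)))"
          by (simp add: ennreal_mult mult_ac)
      qed
      also have "\<dots> = ennreal (norm w powr (p * j + (n / m) * (p * i))) * ennreal (2 * pi / (p * i + 2))"
        using pi by (simp add: nn_integral_cmult_disc_powr)
      finally have *: "(\<integral>\<^sup>+v. indicator (ball 0 1) v * ennreal (norm (monomial (i, j) (of_real (norm w powr (n / m)) * v, w)) powr p) \<partial>lborel)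
         = ennreal (norm w powr (p * j + (n / m) * (p * i))) * ennreal (2 * pi / (p * i + 2))" .
      have "norm w powr c = norm w powr (2 * real n / real m) * norm w powr (p * j + (n / m) * (p * i))"
        by (simp add: c_def algebra_simps flip: powr_add)
      then show ?thesis
        unfolding * using True by (simp add: ennreal_mult mult_ac)
    qed (auto simp: indicator_def)
  qed
  also have "\<dots> = ennreal (2 * pi / (p * i + 2)) * (if c > -2 then ennreal (2 * pi / (c + 2)) else \<infinity>)"
    by (rule nn_integral_cmult_disc_powr)
  also have "\<dots> = (if p * of_int (n * i + m * j) + 2 * real m + 2 * real n > 0
       then ennreal (2 * pi / (p * i + 2) * (2 * pi * m / (p * of_int (n * i + m * j) + 2 * real m + 2 * real n))) else \<infinity>)"
  proof -
    have "c > -2 \<longleftrightarrow> p * of_int (n * i + m * j) + 2 * real m + 2 * real n > 0"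
      using c m by (smt (verit) divide_pos_pos divide_le_0_iff of_nat_0_less_iff)
    \<comment> \<open>In \<open>ennreal\<close> zero times infinity is zero, so divergence survives
      only with a nonzero factor.\<close>
    moreover have "ennreal (2 * pi / (p * i + 2)) \<noteq> 0" using pi by simp
    moreover have "2 * pi / (p * i + 2) \<ge> 0" using pi by simp
    ultimately show ?thesis
      by (simp add: c ennreal_mult_top flip: ennreal_mult')
  qed
  finally show ?thesis .
qed

lemma borel_measurable_dV: "f \<in> borel_measurable borel \<Longrightarrow> f \<in> borel_measurable (dV m n)"
  by (intro measurable_restrict_space1 measurable_completion) simp

lemma space_dV: "space (dV m n) = hartogs m n"
  by (simp add: space_restrict_space)

text \<open>The domain contains points with vanishing first coordinate but none with vanishing
  second coordinate, so only the first exponent is restricted. The obstruction is tested at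
  \<open>(0, 1 / 2)\<close>.\<close>

lemma holomorphic_monomial:
  fixes i j :: int
  assumes "m > 0"  "n > 0"
  shows "holomorphic2_on (monomial (i, j)) (hartogs m n) \<longleftrightarrow> i \<ge> 0"
proof
  assume i: "i \<ge> 0"
  show "holomorphic2_on (monomial (i, j)) (hartogs m n)"
    unfolding holomorphic2_on_def
  proof
    fix z assume z: "z \<in> hartogs m n"
    then have z2: "snd z \<noteq> 0"
      by (auto simp: hartogs_def not_less)
    obtain a where a: "((\<lambda>u. u powi i) has_field_derivative a) (at (fst z))"
      using DERIV_power_int[OF DERIV_ident disjI1[OF i]] by blast
    obtain b where b: "((\<lambda>u. u powi j) has_field_derivative b) (at (snd z))"
      using DERIV_power_int[OF DERIV_ident disjI2[OF z2]] by blast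
    have "((\<lambda>z. fst z powi i) has_derivative (\<lambda>v. a * fst v)) (at z)"
      by (rule has_derivative_compose[OF has_derivative_fst[OF has_derivative_ident] a[unfolded has_field_derivative_def]])
    moreover have "((\<lambda>z. snd z powi j) has_derivative (\<lambda>v. b * snd v)) (at z)"
      by (rule has_derivative_compose[OF has_derivative_snd[OF has_derivative_ident] b[unfolded has_field_derivative_def]])
    ultimately have "((\<lambda>z. fst z powi i * snd z powi j) has_derivative
        (\<lambda>v. fst z powi i * (b * snd v) + (a * fst v) * snd z powi j)) (at z)"
      by (rule has_derivative_mult)
    then have "(monomial (i, j) has_derivative
        (\<lambda>v. (a * snd z powi j) * fst v + (fst z powi i * b) * snd v)) (at z)"
      by (simp add: monomial_def[abs_def] algebra_simps)
    then show "\<exists>a b. (monomial (i, j) has_derivative (\<lambda>v. a * fst v + b * snd v)) (at z)"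
      by blast
  qed
next
  assume "holomorphic2_on (monomial (i, j)) (hartogs m n)"
  moreover have "(0, 1 / 2) \<in> hartogs m n" using assms by (simp add: hartogs_def)
  ultimately obtain D where "(monomial (i, j) has_derivative D) (at (0, 1 / 2))"
    unfolding holomorphic2_on_def by blast
  then have "isCont (monomial (i, j)) (0, 1 / 2)"
    by (rule has_derivative_continuous)
  moreover have "((\<lambda>t::real. (complex_of_real t, 1 / 2 :: complex)) \<longlongrightarrow> (of_real 0, 1 / 2)) (at_right 0)"
    by (intro tendsto_intros)
  ultimately have "((\<lambda>t::real. monomial (i, j) (of_real t, 1 / 2)) \<longlongrightarrow> monomial (i, j) (of_real 0, 1 / 2)) (at_right 0)"
    by (intro isCont_tendsto_compose[of _ "monomial (i, j)"]) auto
  then have lim: "((\<lambda>t::real. norm (monomial (i, j) (of_real t, 1 / 2))) \<longlongrightarrow> norm (monomial (i, j) (0, 1 / 2))) (at_right 0)"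
    by (intro tendsto_norm) simp
  show "i \<ge> 0"
  proof (rule ccontr)
    assume i: "\<not> i \<ge> 0"
    \<comment> \<open>For negative \<open>i\<close> the convention \<open>0 powi i = 0\<close> makes
      the value at the limit point 0, so a positive lower bound along \<open>t > 0\<close> already
      contradicts continuity.\<close>
    have "eventually (\<lambda>t::real. t > 0 \<and> t < 1) (at_right 0)"
      by (auto simp: eventually_at_right_field intro!: exI[of _ "1::real"])
    then have "eventually (\<lambda>t::real. norm (monomial (i, j) (of_real t, 1 / 2)) \<ge> (1 / 2) powi j) (at_right 0)"
    proof eventually_elim
      case (elim t)
      have "1 \<le> t powi i"
        using elim i by (simp add: power_int_def one_le_inverse power_le_one)
      then have "1 * (1 / 2) powi j \<le> t powi i * (1 / 2) powi j"
        by (intro mult_right_mono) auto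
      then show ?case
        using elim by (simp add: monomial_def norm_mult norm_power_int norm_divide)
    qed
    from tendsto_lowerbound[OF lim this] have "norm (monomial (i, j) (0, 1 / 2)) \<ge> (1 / 2) powi j"
      by simp
    moreover have "norm (monomial (i, j) (0, 1 / 2)) = 0" using i by (simp add: monomial_def)
    moreover have "(1 / 2 :: real) powi j > 0" by simp
    ultimately show False by linarith
  qed
qed

lemma monomial_integrable_iff:
  fixes i j :: int
  assumes "m > 0" "n > 0" "i \<ge> 0" "p > 0"
  shows "monomial (i, j) \<in> Lp (ereal p) (dV m n) \<longleftrightarrow> p * of_int (n * i + m * j) + 2 * real m + 2 * real n > 0"
proof -
  have "monomial (i, j) \<in> Lp (ereal p) (dV m n) \<longleftrightarrow> (\<integral>\<^sup>+z. ennreal (norm (monomial (i, j) z) powr p) \<partial>dV m n) < \<infinity>"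
    unfolding Lp_def by (simp add: integrable_iff_bounded borel_measurable_dV)
  also have "\<dots> \<longleftrightarrow> p * of_int (n * i + m * j) + 2 * real m + 2 * real n > 0"
    unfolding nn_integral_monomial[OF assms] by simp
  finally show ?thesis .
qed

text \<open>The hypothesis on \<open>n * i + m * j\<close> is square integrability. In the
  reciprocal, the two factors of the denominator become coefficients that are linear in the
  exponents.\<close>

lemma Lp_norm_monomial:
  fixes i j :: int
  assumes "m > 0" "n > 0" "i \<ge> 0" and s: "n * i + m * j + m + n > 0"
  shows "(Lp_norm 2 (dV m n) (monomial (i, j)))\<^sup>2
    = pi\<^sup>2 * m / ((of_int i + 1) * of_int (n * i + m * j + m + n))"
proof -
  have "real_of_int (n * i + m * j + m + n) > 0"
    using s by (subst of_int_0_less_iff)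
  then have s': "real_of_int (n * i + m * j) + m + n > 0" by simp
  then have pos: "2 * real_of_int (n * i + m * j) + 2 * real m + 2 * real n > 0" by simp
  have "(\<integral>z. norm (monomial (i, j) z) powr 2 \<partial>dV m n)
     = enn2real (\<integral>\<^sup>+z. ennreal (norm (monomial (i, j) z) powr 2) \<partial>dV m n)"
    by (rule integral_eq_nn_integral) (auto simp: borel_measurable_dV)
  also have "\<dots> = 2 * pi / (2 * i + 2) * (2 * pi * m / (2 * of_int (n * i + m * j) + 2 * real m + 2 * real n))"
    using pos assms by (subst nn_integral_monomial) (auto intro!: enn2real_ennreal)
  also have "\<dots> = pi\<^sup>2 * m / ((of_int i + 1) * of_int (n * i + m * j + m + n))"
  proof -
    have "2 * pi / (2 * i + 2) = pi / (of_int i + 1)"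
      using assms(3) by (simp add: divide_simps)
    moreover have "2 * pi * m / (2 * of_int (n * i + m * j) + 2 * real m + 2 * real n)
        = pi * m / of_int (n * i + m * j + m + n)"
      using s' by (simp add: divide_simps)
    ultimately show ?thesis by (simp add: power2_eq_square)
  qed
  finally have *: "(\<integral>z. norm (monomial (i, j) z) powr 2 \<partial>dV m n)
     = pi\<^sup>2 * m / ((of_int i + 1) * of_int (n * i + m * j + m + n))" .
  moreover have "\<dots> \<ge> 0" using assms by (auto intro!: divide_nonneg_nonneg mult_nonneg_nonneg simp del: of_int_add of_int_mult)
  ultimately show ?thesis
    unfolding Lp_norm_def * by (simp add: powr_half_sqrt)
qed

section \<open>Index sets of the kernels\<close>

definition monomial_index :: "nat \<Rightarrow> nat \<Rightarrow> int \<Rightarrow> (int \<times> int) set" where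
  "monomial_index m n k = {(i, j). i \<ge> 0 \<and> n * i + m * j \<ge> k}"

text \<open>With \<open>r\<close> the real value of \<open>p\<close>, integrability of a monomial
  with \<open>s = n * i + m * j\<close> means \<open>s > - N / r\<close>. The bounds on
  \<open>p\<close> put \<open>- N / r\<close> into \<open>[k - 1, k)\<close>, and for an integer
  \<open>s\<close> this turns the strict inequality into \<open>s \<ge> k\<close>. The left endpoint
  \<open>p = p_exponent m n k\<close> is included because \<open>s = k - 1\<close> still fails
  there.\<close>

lemma sub_bergman_index_finite:
  assumes m: "m > 0" and n: "n > 0" and k: "k \<le> -1"
    and p: "p \<in> {p_exponent m n k ..< p_exponent m n (k + 1)}"
  shows "sub_bergman_index m n p = monomial_index m n k"
proof -
  define N where "N = 2 * real m + 2 * real n"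
  have N: "N > 0" using m by (simp add: N_def)
  have e: "p_exponent m n k = ereal (N / (1 - k))" "p_exponent m n (k + 1) = ereal (N / - k)"
    using k by (simp_all add: p_exponent_def N_def)
  obtain r where r: "p = ereal r" "N / (1 - k) \<le> r" "r < N / - k"
    using p unfolding e by (cases p) auto
  have "0 < N / (1 - k)" using N k by simp
  then have rp: "r > 0" using r by linarith
  have 1: "N \<le> r * (1 - k)" using r(2) k by (simp add: divide_simps)
  have 2: "r * (- k) < N" using r(3) k by (simp add: divide_simps)
  have iff: "r * of_int s + 2 * real m + 2 * real n > 0 \<longleftrightarrow> s \<ge> k" for s :: int
  proof
    assume "s \<ge> k"
    then have "r * of_int s \<ge> r * of_int k" using rp by simp
    with 2 show "r * of_int s + 2 * real m + 2 * real n > 0" by (simp add: N_def)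
  next
    assume *: "r * of_int s + 2 * real m + 2 * real n > 0"
    show "s \<ge> k"
    proof (rule ccontr)
      assume "\<not> s \<ge> k"
      then have "real_of_int s \<le> of_int (k - 1)" by (subst of_int_le_iff) simp
      then have "r * of_int s \<le> r * of_int (k - 1)" using rp by (intro mult_left_mono) auto
      with 1 * show False by (simp add: N_def algebra_simps)
    qed
  qed
  have "(i, j) \<in> sub_bergman_index m n p \<longleftrightarrow> (i, j) \<in> monomial_index m n k" for i j :: int
    unfolding sub_bergman_index_def monomial_index_def r(1) mem_Collect_eq prod.case
      holomorphic_monomial[OF m n]
    using monomial_integrable_iff[OF m n _ rp] iff by blast
  then show ?thesis by (auto simp only: split_paired_all)
qed

lemma norm_fst_hartogs_le:
  assumes "m > 0" "n > 0" "z \<in> hartogs m n"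
  shows "norm (fst z) ^ m < norm (snd z) ^ n"
proof -
  have "norm (fst z) powr (real m / real n) < norm (snd z)"
    using assms by (auto simp: hartogs_def)
  then have "(norm (fst z) powr (real m / real n)) ^ n < norm (snd z) ^ n"
    using assms by (intro power_strict_mono) auto
  moreover have "(norm (fst z) powr (real m / real n)) ^ n = norm (fst z) ^ m"
    using assms by (cases "fst z = 0") (simp_all add: powr_powr zero_power flip: powr_realpow)
  ultimately show ?thesis by simp
qed

text \<open>For sufficiency the modulus is bounded by 1 through its \<open>m\<close>-th power, to
  which the integral inequality between the two coordinates applies. For necessity, a bounded
  monomial on a domain of finite volume would have integrable \<open>P\<close>-th power for every
  \<open>P\<close>.\<close>

lemma sub_bergman_index_infinity:
  assumes m: "m > 0" and n: "n > 0"
  shows "sub_bergman_index m n \<infinity> = monomial_index m n 0"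
proof -
  have "(monomial (i, j) \<in> Lp \<infinity> (dV m n)) \<longleftrightarrow> n * i + m * j \<ge> 0" if i: "i \<ge> 0" for i j :: int
  proof
    assume s: "n * i + m * j \<ge> 0"
    have "norm (monomial (i, j) z) \<le> 1" if z: "z \<in> hartogs m n" for z
    proof -
      have z2: "0 < norm (snd z)" "norm (snd z) \<le> 1"
        using z by (auto simp: hartogs_def not_less)
      have "norm (monomial (i, j) z) ^ m = (norm (fst z) ^ m) ^ nat i * norm (snd z) powi (j * m)"
      proof -
        have "(norm (fst z) powi i) ^ m = (norm (fst z) ^ m) ^ nat i"
          using i by (simp add: power_int_def mult.commute flip: power_mult)
        moreover have "(norm (snd z) powi j) ^ m = norm (snd z) powi (j * m)"
          by (simp only: power_int_mult power_int_of_nat)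
        ultimately show ?thesis by (simp add: monomial_def norm_mult norm_power_int power_mult_distrib)
      qed
      also have "\<dots> \<le> (norm (snd z) ^ n) ^ nat i * norm (snd z) powi (j * m)"
        using norm_fst_hartogs_le[OF m n z] by (intro mult_right_mono power_mono) auto
      also have "(norm (snd z) ^ n) ^ nat i = norm (snd z) powi (n * i)"
        using i by (simp add: power_int_def nat_mult_distrib flip: power_mult)
      also have "norm (snd z) powi (n * i) * norm (snd z) powi (j * m) = norm (snd z) powi (n * i + m * j)"
        using z2 by (subst power_int_add) (auto simp: mult.commute)
      also have "\<dots> \<le> 1"
        using s z2 by (simp add: power_int_def power_le_one)
      finally show ?thesis using m power_le_one_iff[of "norm (monomial (i, j) z)" m] by simp
    qed
    then have "AE z in dV m n. norm (monomial (i, j) z) \<le> 1"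
      by (intro AE_I2) (simp add: space_dV)
    then show "monomial (i, j) \<in> Lp \<infinity> (dV m n)"
      unfolding Lp_def by (auto simp: borel_measurable_dV)
  next
    assume "monomial (i, j) \<in> Lp \<infinity> (dV m n)"
    then obtain C where "AE z in dV m n. norm (monomial (i, j) z) \<le> C"
      by (auto simp: Lp_def)
    then have C: "AE z in dV m n. norm (monomial (i, j) z) \<le> max C 0"
      by (rule eventually_mono) auto
    \<comment> \<open>With this exponent integrability means \<open>n * i + m * j > -1\<close>, so
      every negative integer value is excluded at once.\<close>
    define P where "P = 2 * real m + 2 * real n"
    have P: "P > 0" using m by (simp add: P_def)
    show "n * i + m * j \<ge> 0"
    proof (rule ccontr)
      assume "\<not> n * i + m * j \<ge> 0"
      then have "real_of_int (n * i + m * j) \<le> -1" by linarith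
      then have "P * real_of_int (n * i + m * j) \<le> P * (-1)" using P by (intro mult_left_mono) auto
      then have neg: "\<not> P * real_of_int (n * i + m * j) + 2 * real m + 2 * real n > 0" by (simp add: P_def)
      have "\<infinity> = (\<integral>\<^sup>+z. ennreal (norm (monomial (i, j) z) powr P) \<partial>dV m n)"
        using nn_integral_monomial[OF m n i P, of j] neg by simp
      \<comment> \<open>\<open>monomial (0, 0)\<close> is the constant 1, which lets the monomial
        integral supply finiteness of the volume.\<close>
      also have "\<dots> \<le> (\<integral>\<^sup>+z. ennreal (max C 0 powr P) * ennreal (norm (monomial (0, 0) z) powr 1) \<partial>dV m n)"
        using C by (intro nn_integral_mono_AE, elim eventually_mono)
          (use P in \<open>auto simp: monomial_def intro!: ennreal_leI powr_mono2\<close>)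
      also have "\<dots> = ennreal (max C 0 powr P) * (\<integral>\<^sup>+z. ennreal (norm (monomial (0, 0) z) powr 1) \<partial>dV m n)"
        by (intro nn_integral_cmult borel_measurable_dV) measurable
      also have "\<dots> < \<infinity>"
        using m n by (subst nn_integral_monomial) (auto simp: ennreal_mult_less_top)
      finally show False by simp
    qed
  qed
  then show ?thesis
    unfolding sub_bergman_index_def monomial_index_def
    using m n by (auto simp: holomorphic_monomial)
qed

section \<open>The kernel in closed form\<close>

text \<open>The sum of \<open>(a * j + b) * u ^ j\<close> over \<open>j \<ge> 0\<close> in the open
  disc: the linear coefficient is the source of the double pole.\<close>

definition lin_geom :: "complex \<Rightarrow> complex \<Rightarrow> complex \<Rightarrow> complex" where
  "lin_geom a b u = a * u / (1 - u)\<^sup>2 + b / (1 - u)"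

lemma has_sum_lin_geom:
  fixes a b u :: complex
  assumes u: "norm u < 1"
  shows "(\<lambda>j::nat. norm ((a * of_nat j + b) * u ^ j)) summable_on UNIV"
    and "((\<lambda>j::nat. (a * of_nat j + b) * u ^ j) has_sum lin_geom a b u) UNIV"
proof -
  have nz: "1 - u \<noteq> 0" using u by auto
  have s1: "(\<lambda>n. of_nat (Suc n) * u ^ n) sums (1 / (1 - u)\<^sup>2)"
    using u by (rule geometric_deriv_sums)
  have s2: "(\<lambda>n. u ^ n) sums (1 / (1 - u))"
    using u by (rule geometric_sums)
  \<comment> \<open>Writing \<open>a * n + b\<close> as \<open>a * (n + 1) + (b - a)\<close> leaves
    the geometric series and its derivative.\<close>
  have "(\<lambda>n. a * (of_nat (Suc n) * u ^ n) + (b - a) * u ^ n) sums (a * (1 / (1 - u)\<^sup>2) + (b - a) * (1 / (1 - u)))"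
    by (intro sums_add sums_mult s1 s2)
  moreover have "a * (1 / (1 - u)\<^sup>2) + (b - a) * (1 / (1 - u)) = lin_geom a b u"
    using nz by (simp add: lin_geom_def divide_simps power2_eq_square) (simp add: algebra_simps)
  moreover have "a * (of_nat (Suc n) * u ^ n) + (b - a) * u ^ n = (a * of_nat n + b) * u ^ n" for n
    by (simp add: algebra_simps)
  ultimately have sums: "(\<lambda>n. (a * of_nat n + b) * u ^ n) sums lin_geom a b u" by simp
  have "norm (norm u) < 1" using u by simp
  from geometric_deriv_sums[OF this] geometric_sums[OF this]
  have "summable (\<lambda>n. norm a * (of_nat (Suc n) * norm u ^ n) + norm (b - a) * norm u ^ n)"
    by (intro summable_add summable_mult) (auto simp: sums_iff)
  then have abs: "summable (\<lambda>n. norm ((a * of_nat n + b) * u ^ n))"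
  proof (rule summable_comparison_test[OF exI, OF allI, OF impI, rotated])
    fix n
    have "(a * of_nat n + b) * u ^ n = a * (of_nat (Suc n) * u ^ n) + (b - a) * u ^ n"
      by (simp add: algebra_simps)
    also have "norm \<dots> \<le> norm (a * (of_nat (Suc n) * u ^ n)) + norm ((b - a) * u ^ n)"
      by (rule norm_triangle_ineq)
    also have "\<dots> = norm a * (of_nat (Suc n) * norm u ^ n) + norm (b - a) * norm u ^ n"
      by (simp only: norm_mult norm_power norm_of_nat)
    finally show "norm (norm ((a * of_nat n + b) * u ^ n)) \<le> norm a * (of_nat (Suc n) * norm u ^ n) + norm (b - a) * norm u ^ n"
      by simp
  qed
  show "((\<lambda>j::nat. (a * of_nat j + b) * u ^ j) has_sum lin_geom a b u) UNIV"
    using norm_summable_imp_has_sum[OF abs sums] .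
  show "(\<lambda>j::nat. norm ((a * of_nat j + b) * u ^ j)) summable_on UNIV"
    using norm_summable_imp_summable_on[of "\<lambda>j. norm ((a * of_nat j + b) * u ^ j)"] abs by simp
qed

text \<open>Over the common denominator the numerator is \<open>a * u + b * (1 - u)\<close>, and
  \<open>norm (1 - u) \<le> 2\<close>.\<close>

lemma norm_lin_geom_le:
  assumes "norm u < 1" "a \<ge> 0" "b \<ge> 0"
  shows "norm (lin_geom (of_real a) (of_real b) u) \<le> (a + 2 * b) / (norm (1 - u))\<^sup>2"
proof -
  have nz: "1 - u \<noteq> 0" using assms by auto
  have "lin_geom (of_real a) (of_real b) u = (of_real a * u + of_real b * (1 - u)) / (1 - u)\<^sup>2"
    using nz by (simp add: lin_geom_def divide_simps power2_eq_square)
  also have "norm \<dots> = norm (of_real a * u + of_real b * (1 - u)) / (norm (1 - u))\<^sup>2"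
    by (simp add: norm_divide norm_power)
  also have "norm (of_real a * u + of_real b * (1 - u)) \<le> a + 2 * b"
  proof -
    have "norm (1 - u) \<le> 2" using norm_triangle_ineq4[of 1 u] assms by simp
    then have "b * norm (1 - u) \<le> b * 2" using assms by (intro mult_left_mono)
    moreover have "a * norm u \<le> a * 1" using assms by (intro mult_left_mono) auto
    ultimately show ?thesis
      using norm_triangle_ineq[of "of_real a * u" "of_real b * (1 - u)"] assms
      by (simp add: norm_mult)
  qed
  finally show ?thesis using nz by (simp add: divide_right_mono)
qed

lemma has_sum_product:
  fixes f :: "'a \<Rightarrow> complex" and g :: "'b \<Rightarrow> complex"
  assumes "(\<lambda>a. norm (f a)) summable_on A" "(f has_sum x) A" "(\<lambda>b. norm (g b)) summable_on B" "(g has_sum y) B"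
  shows "((\<lambda>(a, b). f a * g b) has_sum (x * y)) (A \<times> B)"
proof (rule has_sum_SigmaI)
  show "((\<lambda>b. case (a, b) of (a, b) \<Rightarrow> f a * g b) has_sum (f a * y)) B" for a
    using has_sum_cmult_right[OF assms(4)] by simp
  show "((\<lambda>a. f a * y) has_sum x * y) A"
    using has_sum_cmult_left[OF assms(2)] by simp
  have "(\<lambda>x. norm (case x of (a, b) \<Rightarrow> f a * g b)) summable_on A \<times> B"
    unfolding Infinite_Sum.abs_summable_on_Sigma_iff
    using assms(1,3) by (auto simp: norm_mult abs_mult infsum_cmult_right' intro!: summable_on_cmult_right summable_on_cmult_left)
  then show "(\<lambda>(a, b). f a * g b) summable_on A \<times> B"
    by (rule abs_summable_summable)
qed

text \<open>This is the ceiling of \<open>(k - n r) / m\<close>, the least second exponent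
  admissible with first exponent \<open>r\<close>; it is written as a negated floor because
  \<open>div\<close> rounds down.\<close>

definition shift_exp :: "nat \<Rightarrow> nat \<Rightarrow> int \<Rightarrow> nat \<Rightarrow> int" where
  "shift_exp m n k r = - ((int n * int r - k) div int m)"

lemma shift_exp_iff:
  assumes "m > 0"
  shows "shift_exp m n k r \<le> j \<longleftrightarrow> k \<le> int n * int r + int m * j"
proof -
  have div: "x \<le> A div int m \<longleftrightarrow> x * int m \<le> A" for x A
  proof -
    have "A = A div int m * int m + A mod int m" "0 \<le> A mod int m" "A mod int m < int m"
      using assms by auto
    then have "A div int m * int m \<le> A" "A < A div int m * int m + int m"
      by linarith+
    moreover have "x \<le> A div int m \<Longrightarrow> x * int m \<le> A div int m * int m"
      by (rule mult_right_mono) auto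
    moreover have "x * int m < A div int m * int m + int m \<Longrightarrow> x < A div int m + 1"
      using assms mult_less_cancel_right_pos[of "int m" x "A div int m + 1"] by (simp add: distrib_right)
    ultimately show ?thesis by linarith
  qed
  have "shift_exp m n k r \<le> j \<longleftrightarrow> - j \<le> (int n * int r - k) div int m"
    by (auto simp: shift_exp_def)
  also have "\<dots> \<longleftrightarrow> - j * int m \<le> int n * int r - k"
    by (rule div)
  also have "\<dots> \<longleftrightarrow> k \<le> int n * int r + int m * j"
    by (auto simp: mult.commute)
  finally show ?thesis .
qed

text \<open>With \<open>u = s\<^sup>m / t\<^sup>n\<close>, the index set is parametrised by \<open>\<alpha>\<^sub>1 = m a + r\<close> and
  \<open>\<alpha>\<^sub>2 = shift_exp m n k r + l - n a\<close> with \<open>r < m\<close> and \<open>a, l \<ge> 0\<close>, and then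
  \<open>s powi \<alpha>\<^sub>1 * t powi \<alpha>\<^sub>2 = s ^ r * t powi shift_exp m n k r * u ^ a * t ^ l\<close>. The coefficient
  also factors into a function of \<open>a\<close> times a function of \<open>l\<close>, so for each \<open>r\<close> the series is
  a product of two geometric-type series.\<close>

definition ratio_coord :: "nat \<Rightarrow> nat \<Rightarrow> complex \<times> complex \<Rightarrow> complex" where
  "ratio_coord m n z = fst z ^ m / snd z ^ n"

text \<open>The constant terms in \<open>lin_geom\<close> are the values at \<open>a = l = 0\<close>
  of \<open>\<alpha>\<^sub>1 + 1\<close> and
  \<open>n \<alpha>\<^sub>1 + m \<alpha>\<^sub>2 + m + n\<close>; these grow with slope
  \<open>m\<close> in \<open>a\<close> and in \<open>l\<close> respectively. The remaining factor
  \<open>1 / (pi\<^sup>2 * m)\<close> comes from the norms of the monomials.\<close>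

definition kernel_sum :: "nat \<Rightarrow> nat \<Rightarrow> int \<Rightarrow> complex \<times> complex \<Rightarrow> complex \<times> complex \<Rightarrow> complex" where
  "kernel_sum m n k z w = (\<Sum>r<m. complex_of_real (1 / (pi\<^sup>2 * real m)) * ((fst z * cnj (fst w)) ^ r * (snd z * cnj (snd w)) powi shift_exp m n k r)
     * (lin_geom (of_real m) (of_real (real r + 1)) (ratio_coord m n z * cnj (ratio_coord m n w))
     * lin_geom (of_real m) (of_real (real_of_int (int n * int r + int m * shift_exp m n k r + int m + int n))) (snd z * cnj (snd w))))"

section \<open>Summation of the kernel series and the majorant\<close>

lemma hartogs_coords:
  assumes "m > 0" "n > 0" "z \<in> hartogs m n"
  shows "snd z \<noteq> 0" "norm (snd z) < 1" "norm (ratio_coord m n z) < 1"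
proof -
  show z: "snd z \<noteq> 0" "norm (snd z) < 1"
    using assms by (auto simp: hartogs_def not_less)
  show "norm (ratio_coord m n z) < 1"
    using norm_fst_hartogs_le[OF assms] z by (simp add: ratio_coord_def norm_divide norm_power)
qed

lemma norm_mult_less_one:
  fixes a b :: complex
  assumes "norm a < 1" "norm b < 1"
  shows "norm (a * cnj b) < 1"
  using mult_strict_mono'[of "norm a" 1 "norm b" 1] assms by (simp add: norm_mult)

lemma kernel_term:
  fixes s t :: complex
  assumes t: "t \<noteq> 0"
  shows "s powi (int m * a + r) * t powi (b + l - int n * a)
    = (s ^ r * t powi b) * ((s ^ m / t ^ n) ^ a * t ^ l)"
proof -
  have "s powi (int m * a + r) = s ^ (m * a + r)"
    by (metis of_nat_add of_nat_mult power_int_of_nat)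
  moreover have "t powi (b + l - int n * a) = t powi b * t ^ l / t ^ (n * a)"
    using t by (simp add: power_int_add power_int_diff flip: power_int_of_nat)
  ultimately show ?thesis
    using t by (simp add: power_add power_mult power_divide)
qed

text \<open>The lower bound on \<open>k\<close> makes \<open>n * i + m * j + m + n\<close> at least
  1 on the index set, so every monomial there is square integrable and the explicit norm formula
  applies.\<close>

lemma has_sum_kernel:
  assumes m: "m > 0" and n: "n > 0" and k: "k \<ge> 1 - int m - int n"
    and z: "z \<in> hartogs m n" and w: "w \<in> hartogs m n"
  shows "((\<lambda>\<alpha>. monomial \<alpha> z * cnj (monomial \<alpha> w) / of_real ((Lp_norm 2 (dV m n) (monomial \<alpha>))\<^sup>2))
    has_sum kernel_sum m n k z w) (monomial_index m n k)"
proof -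
  define s t u where "s = fst z * cnj (fst w)" and "t = snd z * cnj (snd w)"
    and "u = ratio_coord m n z * cnj (ratio_coord m n w)"
  note zc = hartogs_coords[OF m n z] and wc = hartogs_coords[OF m n w]
  have t: "t \<noteq> 0" "norm t < 1" and u: "norm u < 1"
    using zc wc by (auto simp: t_def u_def intro!: norm_mult_less_one)
  have u_eq: "u = s ^ m / t ^ n"
    by (simp add: u_def s_def t_def ratio_coord_def power_mult_distrib)
  define b where "b = shift_exp m n k"
  define d where "d r = n * r + m * b r + m + n" for r
  define g where "g r p = complex_of_real (1 / (pi\<^sup>2 * real m)) * (s ^ r * t powi b r)
     * (case p of (a, l) \<Rightarrow> ((of_real m * of_nat a + of_real (real r + 1)) * u ^ a) * ((of_real m * of_nat l + of_real (d r)) * t ^ l))" 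
    for r :: nat and p :: "nat \<times> nat"
  define G where "G r = complex_of_real (1 / (pi\<^sup>2 * real m)) * (s ^ r * t powi b r)
     * (lin_geom (of_real m) (of_real (real r + 1)) u * lin_geom (of_real m) (of_real (d r)) t)" for r :: nat
  have g: "(g r has_sum G r) (UNIV \<times> UNIV)" for r
    unfolding g_def[abs_def] G_def
    by (intro has_sum_cmult_right has_sum_product has_sum_lin_geom u t)
  have "((\<lambda>(r, p). g r p) has_sum (\<Sum>r<m. G r)) (SIGMA r:{..<m}. UNIV \<times> UNIV)"
  proof -
    have "((\<lambda>(r, p). g r p) has_sum G r) ({r} \<times> (UNIV \<times> UNIV))" for r
    proof -
      have "((\<lambda>(r, p). g r p) has_sum G r) (Pair r ` (UNIV \<times> UNIV))"
        using g[of r] by (subst has_sum_reindex) (auto simp: o_def inj_on_def)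
      moreover have "Pair r ` (UNIV \<times> UNIV) = {r} \<times> ((UNIV :: nat set) \<times> (UNIV :: nat set))" by auto
      ultimately show ?thesis by simp
    qed
    then have "((\<lambda>(r, p). g r p) has_sum (\<Sum>r<m. G r)) (\<Union>r\<in>{..<m}. {r} \<times> (UNIV \<times> UNIV))"
      by (intro sum_has_sum) auto
    moreover have "(\<Union>r\<in>{..<m}. {r} \<times> ((UNIV :: nat set) \<times> (UNIV :: nat set))) = (SIGMA r:{..<m}. UNIV \<times> UNIV)"
      by auto
    ultimately show ?thesis by simp
  qed
  moreover have "((\<lambda>(r, p). g r p) has_sum (\<Sum>r<m. G r)) (SIGMA r:{..<m}. UNIV \<times> UNIV)
    \<longleftrightarrow> ((\<lambda>\<alpha>. monomial \<alpha> z * cnj (monomial \<alpha> w) / of_real ((Lp_norm 2 (dV m n) (monomial \<alpha>))\<^sup>2))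
      has_sum (\<Sum>r<m. G r)) (monomial_index m n k)"
  \<comment> \<open>\<open>r\<close> and \<open>a\<close> are the remainder and quotient of the
    first exponent by \<open>m\<close>; \<open>l\<close> is the height of the second exponent above
    its least admissible value \<open>b r - n a\<close>.\<close>
  proof (rule has_sum_reindex_bij_witness[where
        j = "\<lambda>(r, a, l). (int m * int a + int r, b r + int l - int n * int a)" and
        i = "\<lambda>(i, j). (nat (i mod int m), nat (i div int m), nat (j - b (nat (i mod int m)) + int n * (i div int m)))"])
    fix x assume x: "(x :: nat \<times> nat \<times> nat) \<in> (SIGMA r:{..<m}. UNIV \<times> UNIV)"
    obtain r a l where x_eq: "x = (r, a, l)" by (cases x) auto
    with x have r: "r < m" by simp
    have md: "(int m * int a + int r) mod int m = int r" "(int m * int a + int r) div int m = int a"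
      "int r mod int m = int r"
      using r m by (simp_all add: div_add1_eq)
    show "(case case x of (r, a, l) \<Rightarrow> (int m * int a + int r, b r + int l - int n * int a) of
       (i, j) \<Rightarrow> (nat (i mod int m), nat (i div int m), nat (j - b (nat (i mod int m)) + int n * (i div int m)))) = x"
      by (simp add: x_eq md)
    have "k \<le> int n * int r + int m * (b r + int l)"
      using shift_exp_iff[OF m, of n k r "b r + int l"] by (simp add: b_def)
    then show mem: "(case x of (r, a, l) \<Rightarrow> (int m * int a + int r, b r + int l - int n * int a)) \<in> monomial_index m n k"
      by (simp add: x_eq monomial_index_def algebra_simps)
    define i j where "i = int m * int a + int r" and "j = b r + int l - int n * int a"
    have ij: "i \<ge> 0" "n * i + m * j \<ge> k"
      using mem by (simp_all add: x_eq monomial_index_def i_def j_def)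
    then have pos: "n * i + m * j + m + n > 0" using k by simp
    \<comment> \<open>The terms \<open>n * m * a\<close> cancel, which is why this factor depends on
      \<open>l\<close> and \<open>r\<close> only.\<close>
    have e1: "n * i + m * j + m + n = int m * int l + d r"
      by (simp add: i_def j_def d_def algebra_simps)
    have "monomial (i, j) z * cnj (monomial (i, j) w) = s powi i * t powi j"
      by (simp add: monomial_def s_def t_def power_int_mult_distrib)
    also have "\<dots> = (s ^ r * t powi b r) * (u ^ a * t ^ l)"
      unfolding i_def j_def u_eq using t by (intro kernel_term)
    finally have e2: "monomial (i, j) z * cnj (monomial (i, j) w) = (s ^ r * t powi b r) * (u ^ a * t ^ l)" .
    have e3: "(Lp_norm 2 (dV m n) (monomial (i, j)))\<^sup>2 = pi\<^sup>2 * m / ((of_int i + 1) * of_int (n * i + m * j + m + n))"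
      using m n ij(1) pos by (rule Lp_norm_monomial)
    have e4: "complex_of_real ((Lp_norm 2 (dV m n) (monomial (i, j)))\<^sup>2)
      = pi\<^sup>2 * m / ((of_real m * of_nat a + of_real (real r + 1)) * (of_real m * of_nat l + of_real (d r)))"
      unfolding e3 e1 by (simp add: i_def)
    show "(\<lambda>\<alpha>. monomial \<alpha> z * cnj (monomial \<alpha> w) / of_real ((Lp_norm 2 (dV m n) (monomial \<alpha>))\<^sup>2))
       (case x of (r, a, l) \<Rightarrow> (int m * int a + int r, b r + int l - int n * int a)) = (case x of (r, p) \<Rightarrow> g r p)"
      unfolding x_eq prod.case i_def[symmetric] j_def[symmetric] e2 e4 g_def
      by (simp add: mult_ac)
  next
    fix y assume y: "y \<in> monomial_index m n k"
    obtain i j where y_eq: "y = (i, j)" by (cases y)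
    define r a where "r = nat (i mod int m)" and "a = nat (i div int m)"
    have i: "i \<ge> 0" and s: "n * i + m * j \<ge> k" using y by (auto simp: y_eq monomial_index_def)
    have ra: "int r = i mod int m" "int a = i div int m" using i m by (simp_all add: r_def a_def pos_imp_zdiv_nonneg_iff)
    then have ieq: "i = int m * int a + int r" by simp
    have "k \<le> int n * int r + int m * (j + int n * int a)"
      using s by (simp add: ieq algebra_simps)
    then have l: "j - b r + int n * int a \<ge> 0"
      using shift_exp_iff[OF m, of n k r "j + int n * int a"] by (simp add: b_def)
    have "r < m" using m by (simp add: r_def nat_less_iff)
    then show "(case y of (i, j) \<Rightarrow> (nat (i mod int m), nat (i div int m), nat (j - b (nat (i mod int m)) + int n * (i div int m))))
      \<in> (SIGMA r:{..<m}. UNIV \<times> UNIV)"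
      by (simp add: y_eq r_def)
    show "(case case y of (i, j) \<Rightarrow> (nat (i mod int m), nat (i div int m), nat (j - b (nat (i mod int m)) + int n * (i div int m))) of
       (r, a, l) \<Rightarrow> (int m * int a + int r, b r + int l - int n * int a)) = y"
      unfolding y_eq prod.case ra[symmetric] nat_int using l ieq by simp
  qed simp
  ultimately have "((\<lambda>\<alpha>. monomial \<alpha> z * cnj (monomial \<alpha> w) / of_real ((Lp_norm 2 (dV m n) (monomial \<alpha>))\<^sup>2))
      has_sum (\<Sum>r<m. G r)) (monomial_index m n k)"
    by blast
  moreover have "(\<Sum>r<m. G r) = kernel_sum m n k z w"
    unfolding kernel_sum_def G_def d_def b_def s_def t_def u_def by simp
  ultimately show ?thesis by simp
qed

text \<open>On the domain \<open>norm s \<le> norm t powr (n / m)\<close>. Hence the monomial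
  prefactor of the \<open>r\<close>-th summand is at most \<open>norm t\<close> raised to
  \<open>(n r + m * shift_exp m n k r) / m\<close>, an exponent of at least \<open>k / m\<close>,
  and \<open>norm t < 1\<close>. The two \<open>lin_geom\<close> factors supply the
  denominators.\<close>

lemma norm_kernel_sum_le:
  assumes m: "m > 0" and n: "n > 0" and k: "k \<ge> 1 - int m - int n"
  obtains C where "C \<ge> 0" "\<And>z w. z \<in> hartogs m n \<Longrightarrow> w \<in> hartogs m n \<Longrightarrow>
    norm (kernel_sum m n k z w) \<le> C * (norm (snd z * cnj (snd w)) powr (k / m)
      / ((norm (1 - ratio_coord m n z * cnj (ratio_coord m n w)))\<^sup>2 * (norm (1 - snd z * cnj (snd w)))\<^sup>2))"
proof -
  define d where "d r = real_of_int (n * r + m * shift_exp m n k r + m + n)" for r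
  have kd: "k \<le> n * r + m * shift_exp m n k r" for r
    using shift_exp_iff[OF m, of n k r "shift_exp m n k r"] by simp
  have "0 \<le> n * r + m * shift_exp m n k r + m + n" for r
    using kd[of r] k by simp
  then have d: "d r \<ge> 0" for r
    unfolding d_def by (simp only: of_int_0_le_iff)
  define c where "c r = 1 / (pi\<^sup>2 * m) * ((real m + 2 * (real r + 1)) * (real m + 2 * d r))" for r
  have c: "c r \<ge> 0" for r using d[of r] by (simp add: c_def)
  define C where "C = (\<Sum>r<m. c r)"
  have "norm (kernel_sum m n k z w) \<le> C * (norm (snd z * cnj (snd w)) powr (k / m)
      / ((norm (1 - ratio_coord m n z * cnj (ratio_coord m n w)))\<^sup>2 * (norm (1 - snd z * cnj (snd w)))\<^sup>2))"
    if z: "z \<in> hartogs m n" and w: "w \<in> hartogs m n" for z w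
  proof -
    define s t u where "s = fst z * cnj (fst w)" and "t = snd z * cnj (snd w)"
      and "u = ratio_coord m n z * cnj (ratio_coord m n w)"
    note zc = hartogs_coords[OF m n z] and wc = hartogs_coords[OF m n w]
    have t: "norm t > 0" "norm t < 1" and u: "norm u < 1"
      using zc wc by (auto simp: t_def u_def intro!: norm_mult_less_one)
    define T where "T = norm t powr (k / m)"
    define U where "U = (norm (1 - u))\<^sup>2"
    define V where "V = (norm (1 - t))\<^sup>2"
    have UV: "U \<ge> 0" "V \<ge> 0" by (auto simp: U_def V_def)
    have st: "norm s ^ m \<le> norm t ^ n"
      using norm_fst_hartogs_le[OF m n z] norm_fst_hartogs_le[OF m n w]
      by (auto simp: s_def t_def norm_mult power_mult_distrib intro!: mult_mono)
    have st': "norm s \<le> norm t powr (n / m)"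
    proof -
      have "(norm t powr (n / m)) ^ m = norm t powr (n / m * m)"
        using t by (simp add: powr_powr flip: powr_realpow)
      also have "\<dots> = norm t ^ n" using m t by (simp add: powr_realpow)
      finally have "norm s ^ m \<le> (norm t powr (n / m)) ^ m" using st by simp
      then show ?thesis using m by (simp add: power_mono_iff)
    qed
    have T: "norm s ^ r * norm t powi shift_exp m n k r \<le> T" for r
    proof -
      have "norm s ^ r * norm t powi shift_exp m n k r
          \<le> (norm t powr (n / m)) ^ r * norm t powi shift_exp m n k r"
        using st' t by (intro mult_right_mono power_mono) auto
      also have "\<dots> = norm t powr (n / m * r + shift_exp m n k r)"
        using t by (simp add: powr_add powr_powr powr_real_of_int' flip: powr_realpow)
      also have "\<dots> \<le> norm t powr (k / m)"
      proof (rule powr_mono')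
        have "real_of_int k \<le> real_of_int (n * r + m * shift_exp m n k r)"
          using kd[of r] by (simp only: of_int_le_iff)
        then show "k / m \<le> n / m * r + shift_exp m n k r"
          using m by (simp add: field_simps)
      qed (use t in auto)
      finally show ?thesis by (simp add: T_def)
    qed
    have "norm (kernel_sum m n k z w) \<le> (\<Sum>r<m. c r * (T / (U * V)))"
      unfolding kernel_sum_def
    proof (rule sum_norm_le)
      fix r
      have 1: "norm (lin_geom (of_real m) (of_real (real r + 1)) u) \<le> (real m + 2 * (real r + 1)) / U"
        unfolding U_def by (rule norm_lin_geom_le) (use u in auto)
      have 2: "norm (lin_geom (of_real m) (of_real (d r)) t) \<le> (real m + 2 * d r) / V"
        unfolding V_def by (rule norm_lin_geom_le) (use t d in auto)
      have "norm (complex_of_real (1 / (pi\<^sup>2 * real m)) * (s ^ r * t powi shift_exp m n k r)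
         * (lin_geom (of_real m) (of_real (real r + 1)) u * lin_geom (of_real m) (of_real (d r)) t))
        = 1 / (pi\<^sup>2 * m) * (norm s ^ r * norm t powi shift_exp m n k r)
         * (norm (lin_geom (of_real m) (of_real (real r + 1)) u) * norm (lin_geom (of_real m) (of_real (d r)) t))"
        by (simp add: norm_mult norm_divide norm_power norm_power_int del: of_real_divide of_real_mult)
      also have "\<dots> \<le> 1 / (pi\<^sup>2 * m) * T * ((real m + 2 * (real r + 1)) / U * ((real m + 2 * d r) / V))"
        using T[of r] 1 2 UV d[of r] by (intro mult_mono mult_left_mono) (auto simp: T_def)
      also have "\<dots> = c r * (T / (U * V))" by (simp add: c_def)
      finally show "norm (complex_of_real (1 / (pi\<^sup>2 * real m)) * ((fst z * cnj (fst w)) ^ r * (snd z * cnj (snd w)) powi shift_exp m n k r)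
     * (lin_geom (of_real m) (of_real (real r + 1)) (ratio_coord m n z * cnj (ratio_coord m n w))
     * lin_geom (of_real m) (of_real (real_of_int (int n * int r + int m * shift_exp m n k r + int m + int n))) (snd z * cnj (snd w)))) \<le> c r * (T / (U * V))"
        by (simp add: s_def t_def u_def d_def)
    qed
    also have "\<dots> = C * (T / (U * V))"
      by (simp only: C_def sum_distrib_right)
    finally show ?thesis by (simp add: T_def U_def V_def t_def u_def)
  qed
  moreover have "C \<ge> 0" unfolding C_def by (intro sum_nonneg c)
  ultimately show ?thesis using that by blast
qed

lemma cnj_borel[measurable]: "cnj \<in> borel_measurable borel"
  by (intro borel_measurable_continuous_onI continuous_intros)

lemma kernel_sum_borel:
  "(\<lambda>(z, w). kernel_sum m n k z w) \<in> borel_measurable borel"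
proof -
  have pi: "(\<lambda>x::complex. x powi j) \<in> borel_measurable borel" for j
    unfolding power_int_def by measurable
  have [measurable]: "(\<lambda>x. f x powi j) \<in> borel_measurable M"
    if "f \<in> borel_measurable M" for f :: "_ \<Rightarrow> complex" and j M
    using measurable_compose[OF that pi] .
  have "(\<lambda>x. kernel_sum m n k (fst x) (snd x)) \<in> borel_measurable ((borel \<Otimes>\<^sub>M borel) \<Otimes>\<^sub>M (borel \<Otimes>\<^sub>M borel))"
    unfolding kernel_sum_def lin_geom_def ratio_coord_def by measurable
  then show ?thesis by (simp add: borel_prod case_prod_beta)
qed

section \<open>Schur's test\<close>

text \<open>Optimising the scale \<open>l\<close> in Young's inequality recovers the Holder bound.
  The optimum would be \<open>l = 0\<close> when \<open>g = 0\<close>, so \<open>g\<close> is first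
  enlarged by \<open>e > 0\<close>.\<close>

lemma powr_le_of_Young_bounds:
  fixes x A g p q :: real
  assumes p: "p > 1" and q: "q > 1" and pq: "1 / p + 1 / q = 1"
    and x: "x \<ge> 0" and A: "A > 0" and g: "g \<ge> 0"
    and bd: "\<And>l. l > 0 \<Longrightarrow> x \<le> l powr q * A / q + l powr -p * g / p"
  shows "x powr p \<le> A powr (p - 1) * g"
proof -
  have *: "x powr p \<le> A powr (p - 1) * (g + e)" if e: "e > 0" for e
  proof -
    \<comment> \<open>Chosen so that \<open>l powr q * A = l powr -p * (g + e)\<close>; for
      conjugate exponents \<open>p + q = p * q\<close>.\<close>
    define l where "l = ((g + e) / A) powr (1 / (p * q))"
    have gA: "(g + e) / A > 0" using g e A by simp
    have ge: "g + e > 0" using g e by simp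
    then have l: "l > 0" using A by (simp add: l_def)
    have lq: "l powr q = ((g + e) / A) powr (1 / p)"
      using p q by (simp add: l_def powr_powr)
    have lp: "l powr -p = ((g + e) / A) powr (1 / p - 1)"
    proof -
      have "- 1 / q = 1 / p - 1" using pq by simp
      then show ?thesis using p q by (simp add: l_def powr_powr)
    qed
    have g': "l powr -p * (g + e) = l powr q * A"
    proof -
      have "l powr -p * (g + e) = ((g + e) / A) powr (1 / p - 1) * ((g + e) / A) powr 1 * A"
        using lp ge A by simp
      also have "\<dots> = l powr q * A" unfolding lq powr_add[symmetric] by simp
      finally show ?thesis .
    qed
    have "x \<le> l powr q * A / q + l powr -p * g / p" by (rule bd[OF l])
    also have "\<dots> \<le> l powr q * A / q + l powr -p * (g + e) / p"
      using p e by (intro add_left_mono divide_right_mono mult_left_mono) auto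
    also have "\<dots> = l powr q * A * (1 / p + 1 / q)"
      unfolding g' by (simp add: field_simps)
    also have "\<dots> = ((g + e) / A) powr (1 / p) * A" by (simp add: pq lq)
    finally have "x powr p \<le> (((g + e) / A) powr (1 / p) * A) powr p"
      using x p by (intro powr_mono2) auto
    also have "\<dots> = (g + e) / A * A powr p"
      using p A ge by (simp add: powr_mult powr_powr)
    also have "\<dots> = A powr (p - 1) * (g + e)"
      using A by (simp add: powr_diff)
    finally show ?thesis .
  qed
  show ?thesis
  proof (rule field_le_epsilon)
    fix e :: real assume e: "e > 0"
    have P: "A powr (p - 1) > 0" using A by simp
    with e have "e / A powr (p - 1) > 0" by simp
    from *[OF this] P show "x powr p \<le> A powr (p - 1) * g + e"
      by (simp add: distrib_left)
  qed
qed

text \<open>Holder's inequality for the measure with density \<open>K\<close>, applied to the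
  product of \<open>h\<close> and \<open>F / h\<close>. Young's inequality with a free scale
  \<open>l\<close> is integrated and the scale is optimised afterwards.\<close>

lemma Schur_pointwise:
  fixes K F h :: "'a \<Rightarrow> real"
  assumes p: "p > 1" and q: "q > 1" and pq: "1 / p + 1 / q = 1"
    and [measurable]: "K \<in> borel_measurable M" "F \<in> borel_measurable M" "h \<in> borel_measurable M"
    and K: "\<And>w. w \<in> space M \<Longrightarrow> 0 \<le> K w" and F: "\<And>w. w \<in> space M \<Longrightarrow> 0 \<le> F w"
    and h: "\<And>w. w \<in> space M \<Longrightarrow> 0 < h w"
    and A: "A > 0" "(\<integral>\<^sup>+w. ennreal (K w * h w powr q) \<partial>M) \<le> ennreal A"
    and G: "(\<integral>\<^sup>+w. ennreal (K w * (F w powr p * h w powr -p)) \<partial>M) = ennreal g" and g: "g \<ge> 0"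
  obtains x where "x \<ge> 0" "(\<integral>\<^sup>+w. ennreal (K w * F w) \<partial>M) = ennreal x" "x powr p \<le> A powr (p - 1) * g"
proof -
  have le: "(\<integral>\<^sup>+w. ennreal (K w * F w) \<partial>M) \<le> ennreal (l powr q * A / q + l powr -p * g / p)"
    if l: "l > 0" for l
  proof -
    have "(\<integral>\<^sup>+w. ennreal (K w * F w) \<partial>M)
      \<le> (\<integral>\<^sup>+w. ennreal (l powr q / q) * ennreal (K w * h w powr q)
          + ennreal (l powr -p / p) * ennreal (K w * (F w powr p * h w powr -p)) \<partial>M)"
    proof (rule nn_integral_mono)
      fix w assume w: "w \<in> space M"
      have "F w = (F w / (l * h w)) * (l * h w)" using l h[OF w] by simp
      also have "\<dots> \<le> (F w / (l * h w)) powr p / p + (l * h w) powr q / q"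
        using l h[OF w] F[OF w] by (intro Youngs_inequality p q pq) auto
      also have "\<dots> = l powr -p / p * (F w powr p * h w powr -p) + l powr q / q * h w powr q"
        using l h[OF w] F[OF w] by (simp add: powr_divide powr_mult powr_minus divide_simps)
      finally have "K w * F w \<le> K w * (l powr -p / p * (F w powr p * h w powr -p) + l powr q / q * h w powr q)"
        using K[OF w] by (rule mult_left_mono)
      also have "\<dots> = l powr q / q * (K w * h w powr q) + l powr -p / p * (K w * (F w powr p * h w powr -p))"
        by (simp add: algebra_simps)
      finally have "ennreal (K w * F w) \<le> ennreal \<dots>" by (rule ennreal_leI)
      also have "\<dots> = ennreal (l powr q / q) * ennreal (K w * h w powr q)
          + ennreal (l powr -p / p) * ennreal (K w * (F w powr p * h w powr -p))"
        using K[OF w] p q by (intro ennreal_lincomb) auto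
      finally show "ennreal (K w * F w) \<le> \<dots>" .
    qed
    also have "\<dots> = ennreal (l powr q / q) * (\<integral>\<^sup>+w. ennreal (K w * h w powr q) \<partial>M)
       + ennreal (l powr -p / p) * (\<integral>\<^sup>+w. ennreal (K w * (F w powr p * h w powr -p)) \<partial>M)"
      by (simp add: nn_integral_add nn_integral_cmult)
    also have "\<dots> \<le> ennreal (l powr q / q) * ennreal A + ennreal (l powr -p / p) * ennreal g"
      unfolding G using A by (intro add_right_mono mult_left_mono) auto
    also have "\<dots> = ennreal (l powr q / q * A + l powr -p / p * g)"
      using A g p q by (intro ennreal_lincomb[symmetric]) auto
    finally show ?thesis by simp
  qed
  have "(\<integral>\<^sup>+w. ennreal (K w * F w) \<partial>M) < \<infinity>"
    using le[of 1] by (rule le_less_trans) auto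
  then obtain x where x: "x \<ge> 0" "(\<integral>\<^sup>+w. ennreal (K w * F w) \<partial>M) = ennreal x"
    by (cases "\<integral>\<^sup>+w. ennreal (K w * F w) \<partial>M") auto
  have "x powr p \<le> A powr (p - 1) * g"
  proof (rule powr_le_of_Young_bounds[OF p q pq x(1) A(1) g])
    fix l :: real assume l: "l > 0"
    have "0 \<le> l powr q * A / q + l powr -p * g / p"
      using A g p q by auto
    then show "x \<le> l powr q * A / q + l powr -p * g / p"
      using le[OF l] by (simp add: x)
  qed
  with x that show ?thesis by blast
qed

text \<open>\<open>G\<close> is the \<open>K\<close>-integral of \<open>(F / h) powr p\<close>.
  Tonelli and the column bound control the integral of \<open>h powr p * G\<close> by that of
  \<open>F powr p\<close>; since \<open>h\<close> is positive, \<open>G\<close> is finite almost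
  everywhere. At such points the row bound and Holder give the \<open>p\<close>-th power of the
  image as at most \<open>C powr (p - 1) * h powr p * G\<close>, and integrating supplies the last
  factor \<open>C\<close>.\<close>

lemma Schur_test_nn:
  fixes K :: "'a \<Rightarrow> 'a \<Rightarrow> real" and F h :: "'a \<Rightarrow> real"
  assumes M: "sigma_finite_measure M"
    and p: "p > 1" and q: "q > 1" and pq: "1 / p + 1 / q = 1"
    and Km: "(\<lambda>(z, w). K z w) \<in> borel_measurable (M \<Otimes>\<^sub>M M)"
    and [measurable]: "F \<in> borel_measurable M" "h \<in> borel_measurable M"
    and K: "\<And>z w. z \<in> space M \<Longrightarrow> w \<in> space M \<Longrightarrow> 0 \<le> K z w"
    and F: "\<And>w. w \<in> space M \<Longrightarrow> 0 \<le> F w"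
    and h: "\<And>w. w \<in> space M \<Longrightarrow> 0 < h w"
    and C: "C > 0"
    and row: "\<And>z. z \<in> space M \<Longrightarrow> (\<integral>\<^sup>+w. ennreal (K z w * h w powr q) \<partial>M) \<le> ennreal (C * h z powr q)"
    and col: "\<And>w. w \<in> space M \<Longrightarrow> (\<integral>\<^sup>+z. ennreal (K z w * h z powr p) \<partial>M) \<le> ennreal (C * h w powr p)"
    and fin: "(\<integral>\<^sup>+w. ennreal (F w powr p) \<partial>M) < \<infinity>"
  shows "AE z in M. (\<integral>\<^sup>+w. ennreal (K z w * F w) \<partial>M) < \<infinity>"
    and "(\<integral>\<^sup>+z. ennreal (enn2real (\<integral>\<^sup>+w. ennreal (K z w * F w) \<partial>M) powr p) \<partial>M)
      \<le> ennreal (C powr p) * (\<integral>\<^sup>+w. ennreal (F w powr p) \<partial>M)"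
proof -
  interpret sigma_finite_measure M by fact
  interpret pair_sigma_finite M M ..
  have Km'[measurable]: "(\<lambda>x. K (fst x) (snd x)) \<in> borel_measurable (M \<Otimes>\<^sub>M M)"
    using Km by (simp add: case_prod_beta)
  have [measurable]: "K z \<in> borel_measurable M" if "z \<in> space M" for z
    using measurable_Pair2[OF Km' that] by simp
  have [measurable]: "(\<lambda>z. K z w) \<in> borel_measurable M" if "w \<in> space M" for w
    using measurable_Pair1[OF Km' that] by simp
  define G where "G z = (\<integral>\<^sup>+w. ennreal (K z w * (F w powr p * h w powr -p)) \<partial>M)" for z
  have [measurable]: "G \<in> borel_measurable M"
    unfolding G_def[abs_def] by measurable
  have "(\<integral>\<^sup>+z. ennreal (h z powr p) * G z \<partial>M)
    = (\<integral>\<^sup>+z. \<integral>\<^sup>+w. ennreal (h z powr p) * ennreal (K z w * (F w powr p * h w powr -p)) \<partial>M \<partial>M)"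
    unfolding G_def by (intro nn_integral_cong nn_integral_cmult[symmetric]) measurable
  also have "\<dots> = (\<integral>\<^sup>+w. \<integral>\<^sup>+z. ennreal (h z powr p) * ennreal (K z w * (F w powr p * h w powr -p)) \<partial>M \<partial>M)"
    by (rule Fubini'[symmetric]) measurable
  also have "\<dots> = (\<integral>\<^sup>+w. \<integral>\<^sup>+z. ennreal (F w powr p * h w powr -p) * ennreal (K z w * h z powr p) \<partial>M \<partial>M)"
    using K by (intro nn_integral_cong) (simp add: ennreal_mult mult_ac)
  also have "\<dots> = (\<integral>\<^sup>+w. ennreal (F w powr p * h w powr -p) * (\<integral>\<^sup>+z. ennreal (K z w * h z powr p) \<partial>M) \<partial>M)"
    by (intro nn_integral_cong nn_integral_cmult) measurable
  also have "\<dots> \<le> (\<integral>\<^sup>+w. ennreal C * ennreal (F w powr p) \<partial>M)"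
  proof (rule nn_integral_mono)
    fix w assume w: "w \<in> space M"
    have "ennreal (F w powr p * h w powr -p) * (\<integral>\<^sup>+z. ennreal (K z w * h z powr p) \<partial>M)
      \<le> ennreal (F w powr p * h w powr -p) * ennreal (C * h w powr p)"
      by (intro mult_left_mono col w) auto
    also have "\<dots> = ennreal (F w powr p * h w powr -p * (C * h w powr p))"
      using C by (simp add: ennreal_mult)
    also have "F w powr p * h w powr -p * (C * h w powr p) = C * F w powr p"
      using h[OF w] by (simp add: powr_minus)
    finally show "ennreal (F w powr p * h w powr -p) * (\<integral>\<^sup>+z. ennreal (K z w * h z powr p) \<partial>M)
      \<le> ennreal C * ennreal (F w powr p)" using C by (simp add: ennreal_mult)
  qed
  also have "\<dots> = ennreal C * (\<integral>\<^sup>+w. ennreal (F w powr p) \<partial>M)"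
    by (rule nn_integral_cmult) measurable
  finally have total: "(\<integral>\<^sup>+z. ennreal (h z powr p) * G z \<partial>M) \<le> ennreal C * (\<integral>\<^sup>+w. ennreal (F w powr p) \<partial>M)" .
  also have "\<dots> < \<infinity>" using fin by (simp add: ennreal_mult_less_top)
  finally have "AE z in M. ennreal (h z powr p) * G z \<noteq> \<infinity>"
    by (intro nn_integral_PInf_AE) auto
  then have finG: "AE z in M. G z < \<infinity>"
  proof (rule AE_mp, intro AE_I2 impI)
    fix z assume z: "z \<in> space M" and *: "ennreal (h z powr p) * G z \<noteq> \<infinity>"
    have "ennreal (h z powr p) \<noteq> 0" using h[OF z] by simp
    with * show "G z < \<infinity>" by (auto simp: ennreal_mult_eq_top_iff less_top)
  qed
  have pw: "(\<integral>\<^sup>+w. ennreal (K z w * F w) \<partial>M) < \<infinity> \<and>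
      ennreal (enn2real (\<integral>\<^sup>+w. ennreal (K z w * F w) \<partial>M) powr p) \<le> ennreal (C powr (p - 1)) * (ennreal (h z powr p) * G z)"
    if z: "z \<in> space M" and "G z < \<infinity>" for z
  proof -
    obtain g where g: "g \<ge> 0" "G z = ennreal g" using \<open>G z < \<infinity>\<close> by (cases "G z") auto
    have "C * h z powr q > 0" using C h[OF z] by simp
    then obtain x where x: "x \<ge> 0" "(\<integral>\<^sup>+w. ennreal (K z w * F w) \<partial>M) = ennreal x"
      "x powr p \<le> (C * h z powr q) powr (p - 1) * g"
      using Schur_pointwise[OF p q pq, where K = "K z" and M = M and F = F and h = h
         and A = "C * h z powr q" and g = g] K[OF z] F h row[OF z] g z
      by (auto simp: G_def)
    \<comment> \<open>Conjugacy turns the row weight \<open>h z powr q\<close>, raised to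
      \<open>p - 1\<close>, into \<open>h z powr p\<close>, the weight under which \<open>G\<close>
      has been integrated.\<close>
    have "q * (p - 1) = p" using p q pq by (simp add: field_simps)
    then have "(C * h z powr q) powr (p - 1) = C powr (p - 1) * h z powr p"
      using C h[OF z] by (simp add: powr_mult powr_powr)
    with x(3) have "ennreal (x powr p) \<le> ennreal (C powr (p - 1) * (h z powr p * g))"
      by (intro ennreal_leI) (simp add: mult_ac)
    also have "\<dots> = ennreal (C powr (p - 1)) * (ennreal (h z powr p) * G z)"
      using g by (simp add: ennreal_mult)
    finally show ?thesis using x(1) by (simp add: x(2))
  qed
  show "AE z in M. (\<integral>\<^sup>+w. ennreal (K z w * F w) \<partial>M) < \<infinity>"
    using finG by (rule AE_mp) (use pw in \<open>auto intro!: AE_I2\<close>)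
  have "(\<integral>\<^sup>+z. ennreal (enn2real (\<integral>\<^sup>+w. ennreal (K z w * F w) \<partial>M) powr p) \<partial>M)
    \<le> (\<integral>\<^sup>+z. ennreal (C powr (p - 1)) * (ennreal (h z powr p) * G z) \<partial>M)"
    using finG by (intro nn_integral_mono_AE, elim AE_mp) (use pw in \<open>auto intro!: AE_I2\<close>)
  also have "\<dots> = ennreal (C powr (p - 1)) * (\<integral>\<^sup>+z. ennreal (h z powr p) * G z \<partial>M)"
    by (rule nn_integral_cmult) measurable
  also have "\<dots> \<le> ennreal (C powr (p - 1)) * (ennreal C * (\<integral>\<^sup>+w. ennreal (F w powr p) \<partial>M))"
    by (intro mult_left_mono total) auto
  also have "\<dots> = ennreal (C powr p) * (\<integral>\<^sup>+w. ennreal (F w powr p) \<partial>M)"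
  proof -
    have "C powr (p - 1) * C = C powr p" using C by (simp add: powr_diff)
    moreover have "ennreal (C powr (p - 1) * C) = ennreal (C powr (p - 1)) * ennreal C"
      using C by (intro ennreal_mult) auto
    ultimately show ?thesis by (simp only: mult.assoc)
  qed
  finally show "(\<integral>\<^sup>+z. ennreal (enn2real (\<integral>\<^sup>+w. ennreal (K z w * F w) \<partial>M) powr p) \<partial>M)
      \<le> ennreal (C powr p) * (\<integral>\<^sup>+w. ennreal (F w powr p) \<partial>M)" .
qed

text \<open>Domination by the nonnegative kernel \<open>K\<close> gives all three parts of
  boundedness: the almost everywhere convergence of the defining integral, membership in
  \<open>Lp\<close>, and the norm bound with the Schur constant \<open>C\<close> itself.\<close>

lemma Schur_test:
  fixes K :: "'a \<Rightarrow> 'a \<Rightarrow> real" and B :: "'a \<Rightarrow> 'a \<Rightarrow> complex" and h :: "'a \<Rightarrow> real"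
  assumes M: "sigma_finite_measure M"
    and p: "p > 1" and q: "q > 1" and pq: "1 / p + 1 / q = 1"
    and Km: "(\<lambda>(z, w). K z w) \<in> borel_measurable (M \<Otimes>\<^sub>M M)"
    and Bm: "(\<lambda>(z, w). B z w) \<in> borel_measurable (M \<Otimes>\<^sub>M M)"
    and BK: "\<And>z w. z \<in> space M \<Longrightarrow> w \<in> space M \<Longrightarrow> norm (B z w) \<le> K z w"
    and hm: "h \<in> borel_measurable M" and h: "\<And>w. w \<in> space M \<Longrightarrow> 0 < h w"
    and C: "C > 0"
    and row: "\<And>z. z \<in> space M \<Longrightarrow> (\<integral>\<^sup>+w. ennreal (K z w * h w powr q) \<partial>M) \<le> ennreal (C * h z powr q)"
    and col: "\<And>w. w \<in> space M \<Longrightarrow> (\<integral>\<^sup>+z. ennreal (K z w * h z powr p) \<partial>M) \<le> ennreal (C * h w powr p)"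
  shows "integral_op_bounded_on_Lp p M B"
  unfolding integral_op_bounded_on_Lp_def
proof (intro exI[of _ C] ballI)
  interpret sigma_finite_measure M by fact
  have K: "0 \<le> K z w" if "z \<in> space M" "w \<in> space M" for z w
    using BK[OF that] norm_ge_zero order_trans by blast
  have Bm'[measurable]: "(\<lambda>x. B (fst x) (snd x)) \<in> borel_measurable (M \<Otimes>\<^sub>M M)"
    using Bm by (simp add: case_prod_beta)
  have [measurable]: "B z \<in> borel_measurable M" if "z \<in> space M" for z
    using measurable_Pair2[OF Bm' that] by simp
  fix f assume f: "f \<in> Lp (ereal p) M"
  then have [measurable]: "f \<in> borel_measurable M" and fint: "integrable M (\<lambda>x. norm (f x) powr p)"
    by (auto simp: Lp_def)
  have feq: "(\<integral>\<^sup>+w. ennreal (norm (f w) powr p) \<partial>M) = ennreal (\<integral>w. norm (f w) powr p \<partial>M)"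
    by (rule nn_integral_eq_integral[OF fint]) auto
  define J where "J z = (\<integral>\<^sup>+w. ennreal (K z w * norm (f w)) \<partial>M)" for z
  note S = Schur_test_nn[OF M p q pq Km _ hm K _ h C row col, of "\<lambda>w. norm (f w)", folded J_def]
  have S1: "AE z in M. J z < \<infinity>"
    by (rule S) (auto simp: feq)
  have S2: "(\<integral>\<^sup>+z. ennreal (enn2real (J z) powr p) \<partial>M) \<le> ennreal (C powr p) * (\<integral>\<^sup>+w. ennreal (norm (f w) powr p) \<partial>M)"
    by (rule S) (auto simp: feq)
  have le: "(\<integral>\<^sup>+w. ennreal (norm (B z w * f w)) \<partial>M) \<le> J z" if z: "z \<in> space M" for z
    unfolding J_def
    by (intro nn_integral_mono ennreal_leI) (auto simp: norm_mult intro!: mult_right_mono BK z)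
  have int: "AE z in M. integrable M (\<lambda>w. B z w * f w)"
    using S1
  proof (rule AE_mp, intro AE_I2 impI)
    fix z assume z: "z \<in> space M" and J: "J z < \<infinity>"
    have "(\<lambda>w. B z w * f w) \<in> borel_measurable M" using z by measurable
    moreover have "(\<integral>\<^sup>+w. ennreal (norm (B z w * f w)) \<partial>M) < \<infinity>"
      using le[OF z] J by (rule le_less_trans)
    ultimately show "integrable M (\<lambda>w. B z w * f w)" by (rule integrableI_bounded)
  qed
  have Tm[measurable]: "integral_op M B f \<in> borel_measurable M"
    unfolding integral_op_def[abs_def]
    by (rule borel_measurable_lebesgue_integral) (simp add: case_prod_beta)
  have Tle: "AE z in M. norm (integral_op M B f z) \<le> enn2real (J z)"
    using S1 int
  proof (rule AE_mp[OF _ AE_mp], intro AE_I2 impI)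
    fix z assume z: "z \<in> space M" and i: "integrable M (\<lambda>w. B z w * f w)" and J: "J z < \<infinity>"
    have "ennreal (norm (integral_op M B f z)) \<le> (\<integral>\<^sup>+w. ennreal (norm (B z w * f w)) \<partial>M)"
      unfolding integral_op_def by (rule integral_norm_bound_ennreal[OF i])
    also have "\<dots> \<le> J z" by (rule le[OF z])
    finally have "enn2real (ennreal (norm (integral_op M B f z))) \<le> enn2real (J z)"
      using J by (intro enn2real_mono) auto
    then show "norm (integral_op M B f z) \<le> enn2real (J z)" by simp
  qed
  have "(\<integral>\<^sup>+z. ennreal (norm (integral_op M B f z) powr p) \<partial>M) \<le> (\<integral>\<^sup>+z. ennreal (enn2real (J z) powr p) \<partial>M)"
    using Tle by (intro nn_integral_mono_AE, elim eventually_mono) (use p in \<open>auto intro!: ennreal_leI powr_mono2\<close>)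
  also note S2
  also have "ennreal (C powr p) * (\<integral>\<^sup>+w. ennreal (norm (f w) powr p) \<partial>M) = ennreal (C powr p * (\<integral>w. norm (f w) powr p \<partial>M))"
    unfolding feq by (simp add: ennreal_mult')
  finally have bound: "(\<integral>\<^sup>+z. ennreal (norm (integral_op M B f z) powr p) \<partial>M) \<le> ennreal (C powr p * (\<integral>w. norm (f w) powr p \<partial>M))" .
  have Tint: "integrable M (\<lambda>z. norm (integral_op M B f z) powr p)"
    using bound by (intro integrableI_bounded) (auto intro: le_less_trans)
  have nn: "(\<integral>w. norm (f w) powr p \<partial>M) \<ge> 0" by simp
  have "(\<integral>z. norm (integral_op M B f z) powr p \<partial>M) \<le> C powr p * (\<integral>w. norm (f w) powr p \<partial>M)"
    using bound nn by (subst (asm) nn_integral_eq_integral[OF Tint]) auto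
  then have "Lp_norm p M (integral_op M B f) \<le> (C powr p * (\<integral>w. norm (f w) powr p \<partial>M)) powr (1 / p)"
    unfolding Lp_norm_def using p by (intro powr_mono2) auto
  also have "\<dots> = C * Lp_norm p M f"
    unfolding Lp_norm_def using p C nn by (simp add: powr_mult powr_powr)
  finally have norm_le: "Lp_norm p M (integral_op M B f) \<le> C * Lp_norm p M f" .
  have "integral_op M B f \<in> Lp (ereal p) M"
    using Tint by (simp add: Lp_def)
  with int norm_le show "(AE z in M. integrable M (\<lambda>w. B z w * f w)) \<and>
      integral_op M B f \<in> Lp (ereal p) M \<and> Lp_norm p M (integral_op M B f) \<le> C * Lp_norm p M f"
    by blast
qed

section \<open>Boundedness of the kernel operators\<close>

definition kernel_majorant :: "nat \<Rightarrow> nat \<Rightarrow> int \<Rightarrow> complex \<times> complex \<Rightarrow> complex \<times> complex \<Rightarrow> real" where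
  "kernel_majorant m n k z w = norm (snd z * cnj (snd w)) powr (k / m)
     / ((norm (1 - ratio_coord m n z * cnj (ratio_coord m n w)))\<^sup>2 * (norm (1 - snd z * cnj (snd w)))\<^sup>2)"

text \<open>One factor for each place where the majorant can degenerate: vanishing second
  coordinate, second coordinate of modulus 1, and \<open>ratio_coord\<close> of modulus 1.\<close>

definition test_weight :: "nat \<Rightarrow> nat \<Rightarrow> real \<Rightarrow> real \<Rightarrow> complex \<times> complex \<Rightarrow> real" where
  "test_weight m n a \<epsilon> w = norm (snd w) powr a
     * (1 - (norm (snd w))\<^sup>2) powr -\<epsilon> * (1 - (norm (ratio_coord m n w))\<^sup>2) powr -\<epsilon>"

lemma norm_one_minus_mult_cnj: "norm (1 - a * cnj b) = norm (1 - b * cnj a)"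
proof -
  have "norm (1 - a * cnj b) = norm (cnj (1 - a * cnj b))" by (rule complex_mod_cnj[symmetric])
  also have "cnj (1 - a * cnj b) = 1 - b * cnj a" by simp
  finally show ?thesis .
qed

text \<open>By this symmetry a single integral estimate serves for rows and columns.\<close>

lemma kernel_majorant_commute: "kernel_majorant m n k z w = kernel_majorant m n k w z"
  unfolding kernel_majorant_def
  by (simp add: norm_one_minus_mult_cnj[of "ratio_coord m n z"] norm_one_minus_mult_cnj[of "snd z"]
      norm_mult mult.commute)

lemma kernel_majorant_borel: "(\<lambda>x. kernel_majorant m n k (fst x) (snd x)) \<in> borel_measurable borel"
proof -
  have "(\<lambda>x. kernel_majorant m n k (fst x) (snd x)) \<in> borel_measurable ((borel \<Otimes>\<^sub>M borel) \<Otimes>\<^sub>M (borel \<Otimes>\<^sub>M borel))"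
    unfolding kernel_majorant_def ratio_coord_def by measurable
  then show ?thesis by (simp add: borel_prod)
qed

lemma kernel_majorant_borel': "kernel_majorant m n k z \<in> borel_measurable borel"
proof -
  have "kernel_majorant m n k z \<in> borel_measurable (borel \<Otimes>\<^sub>M borel)"
    unfolding kernel_majorant_def[abs_def] ratio_coord_def by measurable
  then show ?thesis by (simp add: borel_prod)
qed

lemma test_weight_borel: "test_weight m n a \<epsilon> \<in> borel_measurable borel"
proof -
  have "test_weight m n a \<epsilon> \<in> borel_measurable (borel \<Otimes>\<^sub>M borel)"
    unfolding test_weight_def[abs_def] ratio_coord_def by measurable
  then show ?thesis by (simp add: borel_prod)
qed

lemma test_weight_pos:
  assumes "m > 0" "n > 0" "w \<in> hartogs m n"
  shows "test_weight m n a \<epsilon> w > 0"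
proof -
  have "(norm (snd w))\<^sup>2 < 1" "(norm (ratio_coord m n w))\<^sup>2 < 1"
    using hartogs_coords[OF assms] by (simp_all add: power_less_one_iff)
  then show ?thesis
    using hartogs_coords[OF assms] unfolding test_weight_def by (intro mult_pos_pos) auto
qed

text \<open>The weights form a family closed under powers, so the Schur conditions for
  \<open>P\<close> and \<open>Q\<close> are instances of one estimate.\<close>

lemma test_weight_powr:
  assumes "m > 0" "n > 0" "w \<in> hartogs m n"
  shows "test_weight m n a \<epsilon> w powr q = test_weight m n (a * q) (\<epsilon> * q) w"
proof -
  have "(norm (snd w))\<^sup>2 < 1" "(norm (ratio_coord m n w))\<^sup>2 < 1"
    using hartogs_coords[OF assms] by (simp_all add: power_less_one_iff)
  then show ?thesis
    by (simp add: test_weight_def powr_mult powr_powr)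
qed

text \<open>The two bounds on \<open>a\<close> act at different places: the lower one makes the
  integral over \<open>w\<close> converge at the origin, the upper one lets
  \<open>norm y powr (k / m)\<close>, which the kernel leaves behind, be replaced by
  \<open>norm y powr a\<close>.\<close>

lemma test_weight_integral_le:
  fixes a \<epsilon> :: real
  assumes m: "m > 0" and n: "n > 0"
    and a: "a \<le> k / m" "a > - (2 * real m + 2 * real n + k) / m" and \<epsilon>: "0 < \<epsilon>" "\<epsilon> < 1"
  obtains C where "C \<ge> 0" "\<And>z. z \<in> hartogs m n \<Longrightarrow>
    (\<integral>\<^sup>+w. ennreal (kernel_majorant m n k z w * test_weight m n a \<epsilon> w) \<partial>dV m n)
      \<le> ennreal (C * test_weight m n a \<epsilon> z)"
proof -
  \<comment> \<open>The exponent of \<open>norm w\<close> collects the Jacobian, the majorant and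
    the weight.\<close>
  define b where "b = 2 * real n / real m + k / m + a"
  have b: "b > -2" using a(2) m by (simp add: b_def field_simps)
  \<comment> \<open>Neither majorant nor weight carries a power of \<open>norm v\<close>, so the
    inner integral has exponent 0.\<close>
  have "(0::real) > -2" by simp
  from nn_integral_disc_kernel_le[OF this \<epsilon> m] obtain C1 where C1: "C1 \<ge> 0"
    "\<And>c. norm (c::complex) < 1 \<Longrightarrow>
      (\<integral>\<^sup>+z. indicator (ball 0 1) z *
         ennreal (norm z powr 0 * (1 - (norm z)\<^sup>2 ^ m) powr -\<epsilon> / (norm (1 - c * z ^ m))\<^sup>2) \<partial>lborel)
        \<le> ennreal (C1 * (1 - (norm c)\<^sup>2) powr -\<epsilon>)" by blast
  from nn_integral_disc_kernel_le[OF b \<epsilon>, of 1] obtain C2 where C2: "C2 \<ge> 0"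
    "\<And>c. norm (c::complex) < 1 \<Longrightarrow>
      (\<integral>\<^sup>+z. indicator (ball 0 1) z *
         ennreal (norm z powr b * (1 - (norm z)\<^sup>2 ^ 1) powr -\<epsilon> / (norm (1 - c * z ^ 1))\<^sup>2) \<partial>lborel)
        \<le> ennreal (C2 * (1 - (norm c)\<^sup>2) powr -\<epsilon>)" by auto
  have "(\<integral>\<^sup>+w. ennreal (kernel_majorant m n k z w * test_weight m n a \<epsilon> w) \<partial>dV m n)
      \<le> ennreal (C1 * C2 * test_weight m n a \<epsilon> z)" if z: "z \<in> hartogs m n" for z
  proof -
    note zc = hartogs_coords[OF m n z]
    define x y where "x = ratio_coord m n z" and "y = snd z"
    have x: "norm x < 1" and y: "0 < norm y" "norm y < 1" using zc by (auto simp: x_def y_def)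
    define X where "X = (1 - (norm x)\<^sup>2) powr -\<epsilon>"
    have X: "X \<ge> 0" by (simp add: X_def)
    define F where "F w = ennreal (kernel_majorant m n k z w * test_weight m n a \<epsilon> w)" for w
    have F: "F \<in> borel_measurable borel"
      unfolding F_def[abs_def]
      by (intro measurable_compose[OF _ measurable_ennreal] borel_measurable_times kernel_majorant_borel' test_weight_borel)
    have inner: "(\<integral>\<^sup>+v. indicator (ball 0 1) v * F (of_real (norm w powr (n / m)) * v, w) \<partial>lborel)
      \<le> ennreal (norm y powr (k / m) * (norm w powr (k / m + a) * (1 - (norm w)\<^sup>2) powr -\<epsilon> / (norm (1 - y * cnj w))\<^sup>2) * (C1 * X))"
      (is "_ \<le> ennreal (?D * (C1 * X))")
      if w: "w \<in> ball 0 1 - {0}" for w :: complex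
    proof -
      define R where "R = norm w powr (n / m)"
      \<comment> \<open>\<open>ratio_coord\<close> at the rescaled point is \<open>v ^ m\<close>
        times a unimodular number. Putting that number into \<open>c\<close> keeps
        \<open>norm c = norm x\<close>, so the inner bound has a factor in \<open>x\<close> that is
        independent of \<open>w\<close>.\<close>
      define c where "c = cnj x * (of_real (norm w ^ n) / w ^ n)"
      have nc: "norm c = norm x" using w by (simp add: c_def norm_mult norm_divide norm_power)
      have Rm: "R ^ m = norm w ^ n"
      proof -
        have "R ^ m = norm w powr (n / m * m)"
          using w by (simp add: R_def powr_powr flip: powr_realpow)
        then show ?thesis using w m by (simp add: powr_realpow)
      qed
      \<comment> \<open>The point \<open>v = 0\<close> is left out because
        \<open>norm v powr 0\<close> is 0 there instead of 1.\<close>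
      have "indicator (ball 0 1) v * F (of_real R * v, w)
         = ennreal ?D * (indicator (ball 0 1) v * ennreal (norm v powr 0 * (1 - (norm v)\<^sup>2 ^ m) powr -\<epsilon> / (norm (1 - c * v ^ m))\<^sup>2))"
        if v: "v \<noteq> 0" for v
      proof -
        have rc: "ratio_coord m n (of_real R * v, w) = of_real (norm w ^ n) / w ^ n * v ^ m"
          by (simp add: ratio_coord_def power_mult_distrib flip: Rm)
        have nr: "(norm (ratio_coord m n (of_real R * v, w)))\<^sup>2 = (norm v)\<^sup>2 ^ m"
          unfolding rc using w by (simp add: norm_mult norm_divide norm_power mult.commute flip: power_mult)
        have "norm (1 - x * cnj (ratio_coord m n (of_real R * v, w))) = norm (1 - c * v ^ m)"
          unfolding norm_one_minus_mult_cnj[of x] rc c_def by (simp add: mult_ac)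
        moreover have "norm (y * cnj w) powr (k / m) * norm w powr a = norm y powr (k / m) * norm w powr (k / m + a)"
          by (simp add: norm_mult powr_mult powr_add)
        ultimately have "kernel_majorant m n k z (of_real R * v, w) * test_weight m n a \<epsilon> (of_real R * v, w)
          = ?D * (norm v powr 0 * (1 - (norm v)\<^sup>2 ^ m) powr -\<epsilon> / (norm (1 - c * v ^ m))\<^sup>2)"
          unfolding kernel_majorant_def test_weight_def snd_conv nr x_def[symmetric] y_def[symmetric]
          using v by (simp add: divide_simps)
        then have "F (of_real R * v, w)
          = ennreal ?D * ennreal (norm v powr 0 * (1 - (norm v)\<^sup>2 ^ m) powr -\<epsilon> / (norm (1 - c * v ^ m))\<^sup>2)"
          unfolding F_def by (simp only: ennreal_mult[symmetric] divide_nonneg_nonneg mult_nonneg_nonneg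
            powr_ge_zero zero_le_power2)
        then show ?thesis by (simp only: mult.left_commute)
      qed
      then have "(\<integral>\<^sup>+v. indicator (ball 0 1) v * F (of_real R * v, w) \<partial>lborel)
        = (\<integral>\<^sup>+v. ennreal ?D * (indicator (ball 0 1) v * ennreal (norm v powr 0 * (1 - (norm v)\<^sup>2 ^ m) powr -\<epsilon> / (norm (1 - c * v ^ m))\<^sup>2)) \<partial>lborel)"
        by (intro nn_integral_cong_AE eventually_mono[OF AE_lborel_singleton[of "0::complex"]]) auto
      also have "\<dots> = ennreal ?D * (\<integral>\<^sup>+v. indicator (ball 0 1) v * ennreal (norm v powr 0 * (1 - (norm v)\<^sup>2 ^ m) powr -\<epsilon> / (norm (1 - c * v ^ m))\<^sup>2) \<partial>lborel)"
      proof (rule nn_integral_cmult)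
        have "(\<lambda>v. indicator (ball 0 1) v * ennreal (norm v powr 0 * (1 - (norm v)\<^sup>2 ^ m) powr -\<epsilon> / (norm (1 - c * v ^ m))\<^sup>2)) \<in> borel_measurable borel"
          by (intro borel_measurable_times_ennreal borel_measurable_indicator) auto
        then show "(\<lambda>v. indicator (ball 0 1) v * ennreal (norm v powr 0 * (1 - (norm v)\<^sup>2 ^ m) powr -\<epsilon> / (norm (1 - c * v ^ m))\<^sup>2)) \<in> borel_measurable lborel"
          by simp
      qed
      also have "\<dots> \<le> ennreal ?D * ennreal (C1 * (1 - (norm c)\<^sup>2) powr -\<epsilon>)"
        by (intro mult_left_mono C1) (use x in \<open>auto simp: nc\<close>)
      also have "\<dots> = ennreal (?D * (C1 * X))"
        unfolding nc X_def by (rule ennreal_mult[symmetric]) (use C1(1) in simp_all)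
      finally show ?thesis by (simp add: R_def)
    qed
    define E where "E = norm y powr (k / m) * (C1 * X)"
    have E: "E \<ge> 0" using C1(1) X by (simp add: E_def)
    have "(\<integral>\<^sup>+w. F w \<partial>dV m n) = (\<integral>\<^sup>+w. indicator (ball 0 1 - {0}) w * (ennreal (norm w powr (2 * n / m)) *
       (\<integral>\<^sup>+v. indicator (ball 0 1) v * F (of_real (norm w powr (n / m)) * v, w) \<partial>lborel)) \<partial>lborel)"
      using nn_integral_hartogs[OF F m n] by simp
    also have "\<dots> \<le> (\<integral>\<^sup>+w. ennreal E * (indicator (ball 0 1) w *
         ennreal (norm w powr b * (1 - (norm w)\<^sup>2 ^ 1) powr -\<epsilon> / (norm (1 - cnj y * w ^ 1))\<^sup>2)) \<partial>lborel)"
    proof (rule nn_integral_mono)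
      fix w :: complex
      show "indicator (ball 0 1 - {0}) w * (ennreal (norm w powr (2 * n / m)) *
       (\<integral>\<^sup>+v. indicator (ball 0 1) v * F (of_real (norm w powr (n / m)) * v, w) \<partial>lborel))
       \<le> ennreal E * (indicator (ball 0 1) w *
         ennreal (norm w powr b * (1 - (norm w)\<^sup>2 ^ 1) powr -\<epsilon> / (norm (1 - cnj y * w ^ 1))\<^sup>2))"
      proof (cases "w \<in> ball 0 1 - {0}")
        case True
        have "ennreal (norm w powr (2 * n / m)) *
           (\<integral>\<^sup>+v. indicator (ball 0 1) v * F (of_real (norm w powr (n / m)) * v, w) \<partial>lborel)
           \<le> ennreal (norm w powr (2 * n / m)) * ennreal (norm y powr (k / m) * (norm w powr (k / m + a) * (1 - (norm w)\<^sup>2) powr -\<epsilon> / (norm (1 - y * cnj w))\<^sup>2) * (C1 * X))"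
          by (intro mult_left_mono inner True) auto
        also have "\<dots> = ennreal (norm w powr (2 * n / m) * (norm y powr (k / m) * (norm w powr (k / m + a) * (1 - (norm w)\<^sup>2) powr -\<epsilon> / (norm (1 - y * cnj w))\<^sup>2) * (C1 * X)))"
          using C1(1) X by (intro ennreal_mult[symmetric]) auto
        also have "norm w powr (2 * n / m) * (norm y powr (k / m) * (norm w powr (k / m + a) * (1 - (norm w)\<^sup>2) powr -\<epsilon> / (norm (1 - y * cnj w))\<^sup>2) * (C1 * X))
          = E * (norm w powr b * (1 - (norm w)\<^sup>2 ^ 1) powr -\<epsilon> / (norm (1 - cnj y * w ^ 1))\<^sup>2)"
          unfolding norm_one_minus_mult_cnj[of y] E_def b_def
          by (simp add: powr_add mult_ac)
        also have "ennreal \<dots> = ennreal E * ennreal (norm w powr b * (1 - (norm w)\<^sup>2 ^ 1) powr -\<epsilon> / (norm (1 - cnj y * w ^ 1))\<^sup>2)"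
          using E by (intro ennreal_mult) auto
        finally show ?thesis using True by simp
      qed simp
    qed
    also have "\<dots> = ennreal E * (\<integral>\<^sup>+w. indicator (ball 0 1) w *
         ennreal (norm w powr b * (1 - (norm w)\<^sup>2 ^ 1) powr -\<epsilon> / (norm (1 - cnj y * w ^ 1))\<^sup>2) \<partial>lborel)"
    proof (rule nn_integral_cmult)
      have "(\<lambda>w. indicator (ball 0 1) w * ennreal (norm w powr b * (1 - (norm w)\<^sup>2 ^ 1) powr -\<epsilon> / (norm (1 - cnj y * w ^ 1))\<^sup>2)) \<in> borel_measurable borel"
        by (intro borel_measurable_times_ennreal borel_measurable_indicator) auto
      then show "(\<lambda>w. indicator (ball 0 1) w * ennreal (norm w powr b * (1 - (norm w)\<^sup>2 ^ 1) powr -\<epsilon> / (norm (1 - cnj y * w ^ 1))\<^sup>2)) \<in> borel_measurable lborel"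
        by simp
    qed
    also have "\<dots> \<le> ennreal E * ennreal (C2 * (1 - (norm (cnj y))\<^sup>2) powr -\<epsilon>)"
      by (intro mult_left_mono C2) (use y in auto)
    also have "\<dots> = ennreal (C1 * C2 * (norm y powr (k / m) * (1 - (norm y)\<^sup>2) powr -\<epsilon> * X))"
      using E C2(1) by (simp add: E_def mult_ac flip: ennreal_mult)
    also have "\<dots> \<le> ennreal (C1 * C2 * test_weight m n a \<epsilon> z)"
    proof (intro ennreal_leI mult_left_mono)
      have "norm y powr (k / m) \<le> norm y powr a"
        using y a(1) by (intro powr_mono') auto
      then have "norm y powr (k / m) * ((1 - (norm y)\<^sup>2) powr -\<epsilon> * X) \<le> norm y powr a * ((1 - (norm y)\<^sup>2) powr -\<epsilon> * X)"
        using X by (intro mult_right_mono) auto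
      then show "norm y powr (k / m) * (1 - (norm y)\<^sup>2) powr -\<epsilon> * X \<le> test_weight m n a \<epsilon> z"
        by (simp add: test_weight_def X_def x_def y_def mult.assoc)
    qed (use C1 C2 in auto)
    finally show ?thesis by (simp add: F_def)
  qed
  moreover have "C1 * C2 \<ge> 0" using C1 C2 by simp
  ultimately show ?thesis using that by blast
qed

section \<open>From the estimate to bounded operators\<close>

lemma sigma_finite_dV: "sigma_finite_measure (dV m n)"
proof (rule sigma_finite_measure_restrict_space)
  show "sigma_finite_measure (lebesgue :: (complex \<times> complex) measure)"
  proof
    obtain A :: "(complex \<times> complex) set set" where A: "countable A" "A \<subseteq> sets lborel"
      "\<Union>A = space lborel" "\<forall>a\<in>A. emeasure lborel a \<noteq> \<infinity>"
      using lborel.sigma_finite_countable by blast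
    then show "\<exists>A. countable A \<and> A \<subseteq> sets (lebesgue :: (complex \<times> complex) measure) \<and> \<Union>A = space lebesgue
        \<and> (\<forall>a\<in>A. emeasure lebesgue a \<noteq> \<infinity>)"
      by (intro exI[of _ A]) auto
  qed
qed simp

text \<open>The identity from \<open>dV m n\<close> to the Borel space is measurable in each factor,
  so Borel functions of the pair stay measurable for the product of the completed measures.\<close>

lemma borel_measurable_dV_pair:
  fixes f :: "(complex \<times> complex) \<times> (complex \<times> complex) \<Rightarrow> 'b :: topological_space"
  assumes "f \<in> borel_measurable borel"
  shows "f \<in> borel_measurable (dV m n \<Otimes>\<^sub>M dV m n)"
proof -
  have id: "(\<lambda>x. x) \<in> dV m n \<rightarrow>\<^sub>M borel"
    by (rule borel_measurable_dV) simp
  have "(\<lambda>x. (fst x, snd x)) \<in> dV m n \<Otimes>\<^sub>M dV m n \<rightarrow>\<^sub>M borel \<Otimes>\<^sub>M borel"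
    by (intro measurable_Pair measurable_compose[OF measurable_fst id] measurable_compose[OF measurable_snd id])
  moreover have "f \<in> borel_measurable (borel \<Otimes>\<^sub>M borel)"
    using assms by (simp only: borel_prod)
  ultimately have "(\<lambda>x. f (fst x, snd x)) \<in> borel_measurable (dV m n \<Otimes>\<^sub>M dV m n)"
    by (rule measurable_compose)
  then show ?thesis by simp
qed

lemma abs_sub_bergman_kernel_eq:
  assumes "m > 0" "n > 0" "k \<ge> 1 - int m - int n" "sub_bergman_index m n p = monomial_index m n k"
    and "z \<in> hartogs m n" "w \<in> hartogs m n"
  shows "abs_sub_bergman_kernel m n p z w = of_real (norm (kernel_sum m n k z w))"
  unfolding abs_sub_bergman_kernel_def sub_bergman_kernel_def assms(4)
  using has_sum_kernel[OF assms(1-3,5,6)] by (simp add: infsumI)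

text \<open>The kernel exponent \<open>p\<close> enters only through its index set, which lets
  finite exponents and \<infinity> be treated alike; \<open>P\<close> is the exponent of the space
  acted on.\<close>

lemma abs_sub_bergman_kernel_bounded:
  fixes P Q a :: real
  assumes m: "m > 0" and n: "n > 0" and k: "k \<ge> 1 - int m - int n"
    and index: "sub_bergman_index m n p = monomial_index m n k"
    and P: "P > 1" and Q: "Q > 1" and PQ: "1 / P + 1 / Q = 1"
    and aP: "a * P \<le> k / m" "a * P > - (2 * real m + 2 * real n + k) / m"
    and aQ: "a * Q \<le> k / m" "a * Q > - (2 * real m + 2 * real n + k) / m"
  shows "integral_op_bounded_on_Lp P (dV m n) (abs_sub_bergman_kernel m n p)"
proof -
  \<comment> \<open>Then \<open>\<epsilon> * P = 1 / Q\<close> and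
    \<open>\<epsilon> * Q = 1 / P\<close>, both in the open unit interval.\<close>
  define \<epsilon> where "\<epsilon> = 1 / (P * Q)"
  have \<epsilon>: "0 < \<epsilon> * P" "\<epsilon> * P < 1" "0 < \<epsilon> * Q" "\<epsilon> * Q < 1" using P Q by (auto simp: \<epsilon>_def)
  obtain C0 where C0: "C0 \<ge> 0" "\<And>z w. z \<in> hartogs m n \<Longrightarrow> w \<in> hartogs m n \<Longrightarrow>
      norm (kernel_sum m n k z w) \<le> C0 * kernel_majorant m n k z w"
    using norm_kernel_sum_le[OF m n k] unfolding kernel_majorant_def by metis
  obtain CP where CP: "CP \<ge> 0" "\<And>z. z \<in> hartogs m n \<Longrightarrow>
      (\<integral>\<^sup>+w. ennreal (kernel_majorant m n k z w * test_weight m n (a * P) (\<epsilon> * P) w) \<partial>dV m n)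
      \<le> ennreal (CP * test_weight m n (a * P) (\<epsilon> * P) z)"
    using test_weight_integral_le[OF m n aP \<epsilon>(1,2)] by blast
  obtain CQ where CQ: "CQ \<ge> 0" "\<And>z. z \<in> hartogs m n \<Longrightarrow>
      (\<integral>\<^sup>+w. ennreal (kernel_majorant m n k z w * test_weight m n (a * Q) (\<epsilon> * Q) w) \<partial>dV m n)
      \<le> ennreal (CQ * test_weight m n (a * Q) (\<epsilon> * Q) z)"
    using test_weight_integral_le[OF m n aQ \<epsilon>(3,4)] by blast
  \<comment> \<open>The summand 1 guarantees strict positivity.\<close>
  define C where "C = C0 * max CP CQ + 1"
  have C: "C > 0" using C0(1) CP(1) by (auto simp: C_def intro!: add_nonneg_pos mult_nonneg_nonneg)
  have est: "(\<integral>\<^sup>+w. ennreal (C0 * kernel_majorant m n k z w * test_weight m n a \<epsilon> w powr q) \<partial>dV m n)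
      \<le> ennreal (C * test_weight m n a \<epsilon> z powr q)"
    if z: "z \<in> hartogs m n" and D: "D \<ge> 0" "D \<le> max CP CQ"
      "(\<integral>\<^sup>+w. ennreal (kernel_majorant m n k z w * test_weight m n (a * q) (\<epsilon> * q) w) \<partial>dV m n)
      \<le> ennreal (D * test_weight m n (a * q) (\<epsilon> * q) z)" for z q D
  proof -
    have "(\<integral>\<^sup>+w. ennreal (C0 * kernel_majorant m n k z w * test_weight m n a \<epsilon> w powr q) \<partial>dV m n)
      = (\<integral>\<^sup>+w. ennreal C0 * ennreal (kernel_majorant m n k z w * test_weight m n (a * q) (\<epsilon> * q) w) \<partial>dV m n)"
      using C0(1) by (intro nn_integral_cong)
        (simp add: space_dV test_weight_powr[OF m n] mult.assoc ennreal_mult' del: ennreal_mult'')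
    also have "\<dots> = ennreal C0 * (\<integral>\<^sup>+w. ennreal (kernel_majorant m n k z w * test_weight m n (a * q) (\<epsilon> * q) w) \<partial>dV m n)"
      by (intro nn_integral_cmult measurable_compose[OF _ measurable_ennreal] borel_measurable_times
           borel_measurable_dV kernel_majorant_borel' test_weight_borel)
    also have "\<dots> \<le> ennreal C0 * ennreal (D * test_weight m n (a * q) (\<epsilon> * q) z)"
      by (intro mult_left_mono D) auto
    also have "\<dots> = ennreal (C0 * D * test_weight m n a \<epsilon> z powr q)"
      using C0(1) D(1) z by (simp add: test_weight_powr[OF m n] mult.assoc flip: ennreal_mult')
    also have "\<dots> \<le> ennreal (C * test_weight m n a \<epsilon> z powr q)"
    proof (intro ennreal_leI mult_right_mono)
      show "C0 * D \<le> C" using mult_left_mono[OF D(2) C0(1)] by (simp add: C_def)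
    qed simp
    finally show ?thesis .
  qed
  show ?thesis
  proof (rule Schur_test[OF sigma_finite_dV P Q PQ, where K = "\<lambda>z w. C0 * kernel_majorant m n k z w"
        and h = "test_weight m n a \<epsilon>" and C = C])
    show "(\<lambda>(z, w). C0 * kernel_majorant m n k z w) \<in> borel_measurable (dV m n \<Otimes>\<^sub>M dV m n)"
      unfolding case_prod_beta
      by (intro borel_measurable_times borel_measurable_const borel_measurable_dV_pair kernel_majorant_borel)
    have "(\<lambda>(z, w). kernel_sum m n k z w) \<in> borel_measurable (dV m n \<Otimes>\<^sub>M dV m n)"
      by (rule borel_measurable_dV_pair[OF kernel_sum_borel])
    then have "(\<lambda>(z, w). complex_of_real (norm (kernel_sum m n k z w))) \<in> borel_measurable (dV m n \<Otimes>\<^sub>M dV m n)"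
      by (simp add: case_prod_beta)
    also have "?this \<longleftrightarrow> (\<lambda>(z, w). abs_sub_bergman_kernel m n p z w) \<in> borel_measurable (dV m n \<Otimes>\<^sub>M dV m n)"
      using abs_sub_bergman_kernel_eq[OF m n k index]
      by (intro measurable_cong) (auto simp: space_pair_measure space_dV)
    finally show "(\<lambda>(z, w). abs_sub_bergman_kernel m n p z w) \<in> borel_measurable (dV m n \<Otimes>\<^sub>M dV m n)" .
    show "norm (abs_sub_bergman_kernel m n p z w) \<le> C0 * kernel_majorant m n k z w"
      if "z \<in> space (dV m n)" "w \<in> space (dV m n)" for z w
      using that C0(2) abs_sub_bergman_kernel_eq[OF m n k index] by (simp add: space_dV)
    show "test_weight m n a \<epsilon> \<in> borel_measurable (dV m n)"
      by (intro borel_measurable_dV test_weight_borel)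
    show "0 < test_weight m n a \<epsilon> w" if "w \<in> space (dV m n)" for w
      using that test_weight_pos[OF m n] by (simp add: space_dV)
    show "(\<integral>\<^sup>+w. ennreal (C0 * kernel_majorant m n k z w * test_weight m n a \<epsilon> w powr Q) \<partial>dV m n)
      \<le> ennreal (C * test_weight m n a \<epsilon> z powr Q)" if "z \<in> space (dV m n)" for z
      using that by (intro est[where D = CQ] CQ) (auto simp: space_dV)
    show "(\<integral>\<^sup>+z. ennreal (C0 * kernel_majorant m n k z w * test_weight m n a \<epsilon> z powr P) \<partial>dV m n)
      \<le> ennreal (C * test_weight m n a \<epsilon> w powr P)" if "w \<in> space (dV m n)" for w
      unfolding kernel_majorant_commute[of m n k _ w]
      using that by (intro est[where D = CP] CP) (auto simp: space_dV)
  qed (rule C)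
qed

theorem proposition4p38:
  fixes m n :: nat and k :: int and p :: ereal
  assumes "m > 0" and "n > 0" and "coprime m n"
    and "k \<in> {1 - int m - int n .. -1}"
    and "p \<in> {p_exponent m n k ..< p_exponent m n (k + 1)}"
  shows "(\<forall>p'::real. ereal p' \<in> {q_exponent m n (k + 1) <..< p_exponent m n (k + 1)} \<longrightarrow>
            integral_op_bounded_on_Lp p' (dV m n) (abs_sub_bergman_kernel m n p)) \<and>
         (\<forall>r::real. 1 < r \<longrightarrow>
            integral_op_bounded_on_Lp r (dV m n) (abs_sub_bergman_kernel m n \<infinity>))"
proof (intro conjI allI impI)
  note m = assms(1) and n = assms(2)
  have k: "1 - int m - int n \<le> k" "k \<le> -1" using assms(4) by auto
  \<comment> \<open>\<open>N / L\<close> is the upper end of the range of exponents and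
    \<open>N / T\<close> its conjugate, as \<open>N = T + L\<close>. The lower bound on
    \<open>k\<close> gives \<open>L < T\<close>.\<close>
  define L T N where "L = - real_of_int k" and "T = 2 * real m + 2 * real n + k" and "N = 2 * real m + 2 * real n"
  have "real_of_int (1 - int m - int n) \<le> real_of_int k" using k(1) by (subst of_int_le_iff)
  then have LT: "L \<ge> 1" "L < T" "N = T + L" using k(2) m n by (simp_all add: L_def T_def N_def)
  have e: "- (A / m) * s = - (A * s) / m" for A s by simp
  \<comment> \<open>With \<open>a = - A / m\<close> the admissible interval for \<open>a * s\<close>
    becomes \<open>L \<le> A * s < T\<close>.\<close>
  have aiff: "- (A / m) * s \<le> k / m \<longleftrightarrow> L \<le> A * s"
    "- (A / m) * s > - (2 * real m + 2 * real n + k) / m \<longleftrightarrow> A * s < T" for A s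
    unfolding e divide_le_cancel divide_less_cancel using m by (auto simp: L_def T_def)
  {
    fix P :: real
    assume P: "ereal P \<in> {q_exponent m n (k + 1) <..< p_exponent m n (k + 1)}"
    have pe: "p_exponent m n (k + 1) = ereal (N / L)"
      using k by (simp add: p_exponent_def N_def L_def)
    have qe: "q_exponent m n (k + 1) = ereal (N / T)"
    proof -
      have "1 - L / N = T / N" using LT by (simp add: field_simps)
      then show ?thesis
        unfolding q_exponent_def conjugate_exponent_def pe using LT by (simp add: one_ereal_def)
    qed
    have P': "N / T < P" "P < N / L" using P by (simp_all add: pe qe)
    have "1 < N / T" using LT by simp
    then have P1: "P > 1" using P' by simp
    define Q where "Q = P / (P - 1)"
    have Q1: "Q > 1" and PQ: "1 / P + 1 / Q = 1" using P1 by (auto simp: Q_def field_simps)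
    have b: "N < P * T" "P * L < N" using P' LT by (simp_all add: field_simps)
    have r: "P / Q = P - 1" "Q / P = 1 / (P - 1)" using P1 by (simp_all add: Q_def field_simps)
    \<comment> \<open>The smallest \<open>A\<close> with \<open>L \<le> A * P\<close> and
      \<open>L \<le> A * Q\<close>, hence the best one for the upper bounds. Equality holds at the
      smaller exponent; at the larger one, \<open>A * s < T\<close> amounts to
      \<open>P < N / L\<close> if \<open>P \<ge> Q\<close> and to \<open>P > N / T\<close>
      otherwise.\<close>
    define A where "A = L / min P Q"
    have "L \<le> A * P \<and> A * P < T \<and> L \<le> A * Q \<and> A * Q < T"
    proof (cases "P \<ge> Q")
      case True
      then have A: "A = L / Q" by (simp add: A_def)
      then have "A * P = L * (P / Q)" "A * Q = L" using Q1 by simp_all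
      then have "A * P = L * (P - 1)" "A * Q = L" by (simp_all add: r)
      moreover have "L \<le> A * P" using True Q1 P1 LT by (simp add: A field_simps)
      moreover have "L * (P - 1) < T" using b LT by (simp add: algebra_simps)
      ultimately show ?thesis using LT by simp
    next
      case False
      then have A: "A = L / P" by (simp add: A_def)
      then have "A * Q = L * (Q / P)" "A * P = L" using P1 by simp_all
      then have "A * Q = L / (P - 1)" "A * P = L" by (simp_all add: r)
      moreover have "L \<le> A * Q" using False Q1 P1 LT by (simp add: A field_simps)
      moreover have "L / (P - 1) < T" using b LT P1 by (simp add: field_simps)
      ultimately show ?thesis using LT by simp
    qed
    with abs_sub_bergman_kernel_bounded[OF m n k(1) sub_bergman_index_finite[OF m n k(2) assms(5)] P1 Q1 PQ, of "- (A / m)"]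
    show "integral_op_bounded_on_Lp P (dV m n) (abs_sub_bergman_kernel m n p)"
      by (simp only: aiff)
  next
    fix r :: real
    assume r: "1 < r"
    define Q where "Q = r / (r - 1)"
    have Q1: "Q > 1" and PQ: "1 / r + 1 / Q = 1" using r by (auto simp: Q_def field_simps)
    \<comment> \<open>For \<infinity> the index set is that of \<open>k = 0\<close>: the majorant
      has no singularity at the origin, and \<open>a = 0\<close> satisfies the constraints for every
      pair of conjugate exponents.\<close>
    have "1 - int m - int n \<le> 0" using m by simp
    from abs_sub_bergman_kernel_bounded[OF m n this sub_bergman_index_infinity[OF m n] r Q1 PQ, of 0]
    show "integral_op_bounded_on_Lp r (dV m n) (abs_sub_bergman_kernel m n \<infinity>)"
      using m n by (simp add: divide_neg_pos)
  }
qed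

end
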